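(* Let $\mathbb{K}$ be a field, let $F=\{f_1,\ldots,f_\ell\}\subseteq\mathbb{K}[x_1,\ldots,x_n][u_1,\ldots,u_m]=\mathbb{K}[X][U]$, and put $\mathfrak{I}:=\langle F\rangle$. Let $\tau=(\mathbf{0},\tau_u)\in\mathbb{R}^{n+m}_{\ge0}$ with $\tau_u\in\mathbb{R}^m_{>0}$, let $\sigma\in\mathbb{R}^{n+m}_{\ge0}$ be such that the segment $\overline{\sigma\tau}$ is generic, and let $\prec_\sigma,\prec_\tau$ be monomial orders refining $\sigma$ and $\tau$, respectively. Consider the following algorithm. Init: compute $G_0:=\underline{GB}(\mathfrak{I},\prec_\sigma)$; set $k:=0$, $\omega_0:=\sigma$, $\prec_0:=\prec_\sigma$. Step 1: if $\prec_k$ is an $\mathfrak{I}$-specific elimination order for the elimination of $U$, return $G:=G_k\cap\mathbb{K}[X]$. Step 2: set $k:=k+1$; find the next weight vector $\omega_k\in\overline{\sigma\tau}$ such that $\overline{\omega_{k-1}\,\omega_k}=\overline{\omega_{k-1}\,\tau}\cap C_{\prec_{k-1}}(\mathfrak{I})$; set $\prec_k:=(\omega_k|\prec_\tau)$; convert $G_{k-1}$ into a Gröbner basis $G_k$ of $\mathfrak{I}$ with respect to $\prec_k$; interreduce $G_k$ (so that $G_k=\underline{GB}(\mathfrak{I},\prec_k)$). Step 3: go to Step 1. Then this algorithm terminates and is correct: after finitely many steps it returns a set $G\subseteq\mathbb{K}[X]$ which is the reduced Gröbner basis of $\langle F\rangle\cap\mathbb{K}[X]$ with respect to some $\langle F\rangle$-specific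 elimination order for the elimination of $U$.
   Context: Write $\mathbb{K}[X]=\mathbb{K}[x_1,\ldots,x_n]$, $U=\{u_1,\ldots,u_m\}$ and $(y_1,\ldots,y_{n+m})=(x_1,\ldots,x_n,u_1,\ldots,u_m)$; for $\alpha\in\mathbb{N}^{n+m}$ put $y^\alpha=\prod_i y_i^{\alpha_i}$. The first $n$ coordinates of a vector in $\mathbb{R}^{n+m}$ correspond to the $x$-variables, the last $m$ to the $u$-variables. For a monomial order $\prec$ on $\mathbb{K}[X][U]$, $\mathrm{lt}_\prec(f)$ is the leading term of $f\neq 0$, and $\langle \mathrm{lt}_\prec(\mathfrak{I})\rangle$ is the ideal generated by all leading terms of nonzero elements of $\mathfrak{I}$. A Gröbner basis $G$ is reduced if for all $g\ne h$ in $G$, $\mathrm{lt}_\prec(g)$ divides no monomial of $h$; it is normed if all leading coefficients are $1$. $\underline{GB}(\mathfrak{I},\prec)$ denotes the unique finite normed reduced Gröbner basis of $\mathfrak{I}$ with respect to $\prec$. Weight vectors are the elements of $\Omega:=\mathbb{R}^{n+m}_{\ge 0}$. For $f=\sum_\alpha f_\alpha y^\alpha\ne 0$ and $\omega\in\Omega$, $\deg_\omega(f):=\max\{\omega^T\alpha : f_\alpha\ne0\}$, and $\mathrm{lt}_\omega(f):=\sum_{\alpha\in A} f_\alpha y^\alpha$ with $A=\{\alpha\in\mathbb{N}^{n+m}: f_\alpha\neq 0,\ \omega^T\alpha=\deg_\omega(f)\}$. $\langle\mathrm{lt}_\omega(\mathfrak{I})\rangle$ is the ideal generated by all $\mathrm{lt}_\omega(f)$,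 $0\neq f\in\mathfrak{I}$. A monomial order $\prec$ refines $\omega$ if for all monomials $m_1,m_2$, $\deg_\omega(m_1)<\deg_\omega(m_2)$ implies $m_1\prec m_2$. The monomial order $(\omega|\prec)$ compares monomials first by $\deg_\omega$ and breaks ties with $\prec$. The Gröbner cone of $\mathfrak{I}$ with respect to $\prec$ is $C_\prec(\mathfrak{I}):=\mathrm{closure}(\{\omega\in\Omega : \langle\mathrm{lt}_\omega(\mathfrak{I})\rangle=\langle\mathrm{lt}_\prec(\mathfrak{I})\rangle\})$, closure in the standard topology of $\mathbb{R}^{n+m}$. Gröbner cones are convex polyhedral cones with non-empty interior. The segment $\overline{\sigma\tau}\subset\Omega$ is called generic if (i) on its way from $\sigma$ to $\tau$ (the endpoint $\tau$ excluded) it only passes through the interior of Gröbner cones of $\mathfrak{I}$ or through (relative) interior points of their facets, and (ii) $\sigma$ lies in the interior of some Gröbner cone $C_{\prec_{\mathrm{start}}}(\mathfrak{I})$. A monomial order $\prec$ is an $\mathfrak{I}$-specific elimination order for the elimination of $U$ if for all $g\in\underline{GB}(\mathfrak{I},\prec)$: $\mathrm{lt}_\prec(g)\in\mathbb{K}[X]$ implies $g\in\mathbb{K}[X]$. *)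

theory Defs
  imports "HOL-Analysis.Analysis" "HOL-Library.Poly_Mapping"
begin

section \<open>Polynomials and monomial orders\<close>

text \<open>
  A monomial is identified with its exponent vector, so that multiplication of monomials
  is addition of exponents and the monomial 1 is 0. The ring structure on polynomials is the
  convolution product of \<^theory>\<open>HOL-Library.Poly_Mapping\<close>.
\<close>

type_synonym 'v monomial = "'v \<Rightarrow>\<^sub>0 nat"
type_synonym ('v, 'a) mpoly = "('v \<Rightarrow>\<^sub>0 nat) \<Rightarrow>\<^sub>0 'a"
type_synonym 'v mrel = "'v monomial \<Rightarrow> 'v monomial \<Rightarrow> bool"

global_interpretation ideal: module "(*) :: 'a::comm_ring_1 \<Rightarrow> 'a \<Rightarrow> 'a"
  defines ideal_gen = ideal.span
  by unfold_locales (simp_all add: algebra_simps)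

definition monomial_order :: "'v mrel \<Rightarrow> bool" where
  "monomial_order prec \<longleftrightarrow>
     irreflp prec \<and> transp prec \<and> totalp prec \<and>
     (\<forall>s. s \<noteq> 0 \<longrightarrow> prec 0 s) \<and>
     (\<forall>s t u. prec s t \<longrightarrow> prec (s + u) (t + u))"

definition lead_mon :: "'v mrel \<Rightarrow> ('v, 'a::zero) mpoly \<Rightarrow> 'v monomial" where
  "lead_mon prec f = (THE s. s \<in> Poly_Mapping.keys f \<and> (\<forall>t\<in>Poly_Mapping.keys f. t \<noteq> s \<longrightarrow> prec t s))"

definition lt :: "'v mrel \<Rightarrow> ('v, 'a::zero) mpoly \<Rightarrow> ('v, 'a) mpoly" where
  "lt prec f = Poly_Mapping.single (lead_mon prec f) (Poly_Mapping.lookup f (lead_mon prec f))"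

definition lc :: "'v mrel \<Rightarrow> ('v, 'a::zero) mpoly \<Rightarrow> 'a" where
  "lc prec f = Poly_Mapping.lookup f (lead_mon prec f)"

definition initial_ideal :: "'v mrel \<Rightarrow> ('v, 'a::comm_ring_1) mpoly set \<Rightarrow> ('v, 'a) mpoly set" where
  "initial_ideal prec I = ideal_gen (lt prec ` (I - {0}))"


section \<open>Groebner bases\<close>

definition is_GB :: "'v mrel \<Rightarrow> ('v, 'a::field) mpoly set \<Rightarrow> ('v, 'a) mpoly set \<Rightarrow> bool" where
  "is_GB prec I G \<longleftrightarrow>
     finite G \<and> G \<subseteq> I \<and> 0 \<notin> G \<and> ideal_gen (lt prec ` G) = initial_ideal prec I"

definition is_reduced_GB :: "'v mrel \<Rightarrow> ('v, 'a::field) mpoly set \<Rightarrow> ('v, 'a) mpoly set \<Rightarrow> bool" where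
  "is_reduced_GB prec I G \<longleftrightarrow>
     is_GB prec I G \<and>
     (\<forall>g\<in>G. \<forall>h\<in>G. g \<noteq> h \<longrightarrow> (\<forall>s\<in>Poly_Mapping.keys h. \<not> lt prec g dvd Poly_Mapping.single s 1)) \<and>
     (\<forall>g\<in>G. lc prec g = 1)"

definition GB :: "('v, 'a::field) mpoly set \<Rightarrow> 'v mrel \<Rightarrow> ('v, 'a) mpoly set" where
  "GB I prec = (THE G. is_reduced_GB prec I G)"


section \<open>Weight vectors and Groebner cones\<close>

definition weights :: "(real ^ 'v::finite) set" where
  "weights = {\<omega>. \<forall>i. 0 \<le> \<omega> $ i}"

definition mon_wdeg :: "real ^ 'v::finite \<Rightarrow> 'v monomial \<Rightarrow> real" where
  "mon_wdeg \<omega> s = (\<Sum>i\<in>UNIV. \<omega> $ i * real (Poly_Mapping.lookup s i))"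

definition wdeg :: "real ^ 'v::finite \<Rightarrow> ('v, 'a::zero) mpoly \<Rightarrow> real" where
  "wdeg \<omega> f = Max (mon_wdeg \<omega> ` Poly_Mapping.keys f)"

definition wlt :: "real ^ 'v::finite \<Rightarrow> ('v, 'a::comm_monoid_add) mpoly \<Rightarrow> ('v, 'a) mpoly" where
  "wlt \<omega> f =
     (\<Sum>s\<in>{s \<in> Poly_Mapping.keys f. mon_wdeg \<omega> s = wdeg \<omega> f}.
        Poly_Mapping.single s (Poly_Mapping.lookup f s))"

definition winitial_ideal ::
  "real ^ 'v::finite \<Rightarrow> ('v, 'a::comm_ring_1) mpoly set \<Rightarrow> ('v, 'a) mpoly set" where
  "winitial_ideal \<omega> I = ideal_gen (wlt \<omega> ` (I - {0}))"

definition refines_weight :: "'v::finite mrel \<Rightarrow> real ^ 'v \<Rightarrow> bool" where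
  "refines_weight prec \<omega> \<longleftrightarrow> (\<forall>s t. mon_wdeg \<omega> s < mon_wdeg \<omega> t \<longrightarrow> prec s t)"

definition weight_order :: "real ^ 'v::finite \<Rightarrow> 'v mrel \<Rightarrow> 'v mrel" where
  "weight_order \<omega> prec s t \<longleftrightarrow>
     mon_wdeg \<omega> s < mon_wdeg \<omega> t \<or> mon_wdeg \<omega> s = mon_wdeg \<omega> t \<and> prec s t"

definition gcone :: "('v::finite, 'a::field) mpoly set \<Rightarrow> 'v mrel \<Rightarrow> (real ^ 'v) set" where
  "gcone I prec = closure {\<omega> \<in> weights. winitial_ideal \<omega> I = initial_ideal prec I}"

definition generic_segment ::
  "('v::finite, 'a::field) mpoly set \<Rightarrow> real ^ 'v \<Rightarrow> real ^ 'v \<Rightarrow> bool" where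
  "generic_segment I \<sigma> \<tau> \<longleftrightarrow>
     (\<forall>p \<in> closed_segment \<sigma> \<tau> - {\<tau>}. \<exists>prec. monomial_order prec \<and>
        (p \<in> interior (gcone I prec) \<or> (\<exists>S. S facet_of gcone I prec \<and> p \<in> rel_interior S))) \<and>
     (\<exists>prec. monomial_order prec \<and> \<sigma> \<in> interior (gcone I prec))"


section \<open>Elimination\<close>

text \<open>
  The variables of \<open>\<K>[X][U] = \<K>[X \<union> U]\<close> are indexed by \<^typ>\<open>'n + 'm\<close>, with \<^const>\<open>Inl\<close>
  for the x-variables and \<^const>\<open>Inr\<close> for the u-variables. The ring \<open>\<K>[X]\<close> itself has variables
  indexed by \<^typ>\<open>'n\<close>; \<open>incl\<close> is its inclusion into \<open>\<K>[X][U]\<close>.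
\<close>

definition incl_mon :: "'n monomial \<Rightarrow> ('n + 'm) monomial" where
  "incl_mon s = (\<Sum>i\<in>Poly_Mapping.keys s. Poly_Mapping.single (Inl i) (Poly_Mapping.lookup s i))"

definition incl :: "('n, 'a::comm_monoid_add) mpoly \<Rightarrow> ('n + 'm, 'a) mpoly" where
  "incl f = (\<Sum>s\<in>Poly_Mapping.keys f. Poly_Mapping.single (incl_mon s) (Poly_Mapping.lookup f s))"

definition KX :: "('n + 'm, 'a::comm_monoid_add) mpoly set" where
  "KX = range incl"

definition restrict_order :: "('n + 'm) mrel \<Rightarrow> 'n mrel" where
  "restrict_order prec s t \<longleftrightarrow> prec (incl_mon s) (incl_mon t)"

definition specific_elim_order ::
  "('n + 'm, 'a::field) mpoly set \<Rightarrow> ('n + 'm) mrel \<Rightarrow> bool" where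
  "specific_elim_order I prec \<longleftrightarrow> (\<forall>g\<in>GB I prec. lt prec g \<in> KX \<longrightarrow> g \<in> KX)"


section \<open>The elimination walk\<close>

definition next_weight ::
  "('v::finite, 'a::field) mpoly set \<Rightarrow> real ^ 'v \<Rightarrow> real ^ 'v \<Rightarrow> real ^ 'v \<Rightarrow> 'v mrel \<Rightarrow> real ^ 'v \<Rightarrow> bool"
where
  "next_weight I \<sigma> \<tau> \<omega> prec \<omega>' \<longleftrightarrow>
     \<omega>' \<in> closed_segment \<sigma> \<tau> \<and>
     closed_segment \<omega> \<omega>' = closed_segment \<omega> \<tau> \<inter> gcone I prec"

text \<open>
  \<open>walk I \<sigma> \<tau> prec\<^sub>\<sigma> prec\<^sub>\<tau> k \<omega> prec G\<close>: the run reaches Step 1 with loop counter \<open>k\<close> and current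
  weight vector \<open>\<omega>\<close>, order \<open>prec\<close> and reduced Groebner basis \<open>G\<close>.
\<close>

inductive walk ::
  "('n::finite + 'm::finite, 'a::field) mpoly set \<Rightarrow> real ^ ('n + 'm) \<Rightarrow> real ^ ('n + 'm) \<Rightarrow>
   ('n + 'm) mrel \<Rightarrow> ('n + 'm) mrel \<Rightarrow>
   nat \<Rightarrow> real ^ ('n + 'm) \<Rightarrow> ('n + 'm) mrel \<Rightarrow> ('n + 'm, 'a) mpoly set \<Rightarrow> bool"
  for I \<sigma> \<tau> prec\<^sub>\<sigma> prec\<^sub>\<tau>
where
  init: "walk I \<sigma> \<tau> prec\<^sub>\<sigma> prec\<^sub>\<tau> 0 \<sigma> prec\<^sub>\<sigma> (GB I prec\<^sub>\<sigma>)"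
| step: "walk I \<sigma> \<tau> prec\<^sub>\<sigma> prec\<^sub>\<tau> (Suc k) \<omega>' (weight_order \<omega>' prec\<^sub>\<tau>) (GB I (weight_order \<omega>' prec\<^sub>\<tau>))"
    if "walk I \<sigma> \<tau> prec\<^sub>\<sigma> prec\<^sub>\<tau> k \<omega> prec G"
      and "\<not> specific_elim_order I prec"
      and "next_weight I \<sigma> \<tau> \<omega> prec \<omega>'"

definition walk_returns ::
  "('n::finite + 'm::finite, 'a::field) mpoly set \<Rightarrow> real ^ ('n + 'm) \<Rightarrow> real ^ ('n + 'm) \<Rightarrow>
   ('n + 'm) mrel \<Rightarrow> ('n + 'm) mrel \<Rightarrow> ('n + 'm, 'a) mpoly set \<Rightarrow> bool"
where
  "walk_returns I \<sigma> \<tau> prec\<^sub>\<sigma> prec\<^sub>\<tau> R \<longleftrightarrow>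
     (\<exists>k \<omega> prec G. walk I \<sigma> \<tau> prec\<^sub>\<sigma> prec\<^sub>\<tau> k \<omega> prec G \<and> specific_elim_order I prec \<and> R = G \<inter> KX)"

end

theory Submission
  imports Defs
begin

text \<open>
  Both claims, termination and correctness, follow from a description of a Groebner cone by
  inequalities. If \<open>G\<close> is the reduced Groebner basis for \<open>prec\<close>, then the Groebner cone of
  \<open>prec\<close> consists of the weights in \<open>weights\<close> for which, in every \<open>g \<in> G\<close>, the leading
  monomial has maximal weight (\<open>gcone_eq\<close>). Hence cones are closed and convex, and if \<open>prec\<close>
  refines \<open>\<omega>\<close>, then \<open>\<omega>\<close> lies in the cone of \<open>prec\<close>. So the intersection in Step 2 is a segment
  that starts at the current weight, and the next weight is its other end.

  Let \<open>\<omega>\<close> be the current weight after at least one step, so that the current order compares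
  by \<open>\<omega>\<close> first and then by an order refining \<open>\<tau>\<close>. An inequality of the cone that is strict at
  \<open>\<omega>\<close> survives a small move, and one that is an equality at \<open>\<omega>\<close> holds at \<open>\<tau>\<close>; so the cone
  reaches from \<open>\<omega>\<close> a bit towards \<open>\<tau>\<close> (\<open>gcone_reaches_towards\<close>), and the walk advances unless
  \<open>\<omega> = \<tau>\<close>. In the latter case the order refines \<open>\<tau>\<close>, for which exactly the monomials in the
  x-variables have weight 0, so it is an elimination order and the algorithm stops. Since the walk
  advances, and a cone that has been left is never met again by convexity, the cones visited are
  pairwise distinct (\<open>walk_passes_cones\<close>). An ideal has only finitely many initial ideals
  (\<open>finite_leads\<close>) and therefore finitely many Groebner cones, whose number bounds the number
  of steps.

  Correctness of the result is the elimination property: the leading monomial of an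
  element of \<open>I\<close> in \<open>K[X]\<close> is divisible by the leading monomial of some \<open>g \<in> G\<close>, which then involves
  x-variables only, so that \<open>g\<close> itself lies in \<open>K[X]\<close> (\<open>is_reduced_GB_elimination_ideal\<close>).

  The facts on Groebner bases rest on Dickson's lemma and on one reduction lemma (\<open>reduction\<close>
  and its corollary \<open>reduced_element\<close>). The description of the cones also requires that every monomial
  order agrees on finitely many comparisons with a nonnegative weight vector, which is obtained by
  Fourier-Motzkin elimination.
\<close>

(* As a simplification rule, a * (b * x) = (a * b) * x loops with mult.assoc and algebra_simps. *)
declare ideal.scale_scale [simp del]

section \<open>Dickson's lemma\<close>

definition mon_dvd :: "'v monomial \<Rightarrow> 'v monomial \<Rightarrow> bool" where
  "mon_dvd s t \<longleftrightarrow> (\<exists>u. t = s + u)"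

lemma mon_dvd_refl [simp]: "mon_dvd s s"
  unfolding mon_dvd_def by (metis add.right_neutral)

lemma mon_dvd_trans: "mon_dvd s t \<Longrightarrow> mon_dvd t u \<Longrightarrow> mon_dvd s u"
  unfolding mon_dvd_def by (metis add.assoc)

lemma mon_dvd_add: "mon_dvd s (u + s)" "mon_dvd s (s + u)"
  unfolding mon_dvd_def by (metis add.commute)+

lemma mon_dvd_iff_lookup_le:
  "mon_dvd s t \<longleftrightarrow> (\<forall>i. Poly_Mapping.lookup s i \<le> Poly_Mapping.lookup t i)"
proof
  assume "mon_dvd s t"
  then show "\<forall>i. Poly_Mapping.lookup s i \<le> Poly_Mapping.lookup t i"
    by (auto simp: mon_dvd_def lookup_add)
next
  assume "\<forall>i. Poly_Mapping.lookup s i \<le> Poly_Mapping.lookup t i"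
  then have "t = s + (t - s)"
    by (intro poly_mapping_eqI) (simp add: lookup_add lookup_minus)
  then show "mon_dvd s t"
    unfolding mon_dvd_def by blast
qed

lemma incseq_subseq_nat:
  fixes f :: "nat \<Rightarrow> nat"
  shows "\<exists>r. strict_mono r \<and> incseq (\<lambda>n. f (r n))"
proof -
  obtain r where r: "strict_mono r" "monoseq (\<lambda>n. f (r n))"
    using seq_monosub[of f] by blast
  show ?thesis
  proof (cases "incseq (\<lambda>n. f (r n))")
    case True
    with r show ?thesis by blast
  next
    case False
    then have dec: "decseq (\<lambda>n. f (r n))"
      using r(2) by (simp add: monoseq_iff)
    (* A decreasing sequence of natural numbers is constant once its minimum is reached. *)
    obtain k where k: "\<And>n. f (r k) \<le> f (r n)"
      using ex_has_least_nat[of "\<lambda>_. True" 0 "\<lambda>n. f (r n)"] by auto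
    have "f (r (k + n)) = f (r k)" for n
      using k[of "k + n"] decseqD[OF dec, of k "k + n"] by simp
    moreover have "strict_mono (\<lambda>n. r (k + n))"
      using r(1) by (simp add: strict_mono_def)
    ultimately show ?thesis
      by (intro exI[of _ "\<lambda>n. r (k + n)"]) (simp add: incseq_def)
  qed
qed

text \<open>
  The coordinates are treated one at a time; thinning out a subsequence preserves the monotonicity
  already achieved.
\<close>

lemma incseq_subseq_monomial:
  fixes s :: "nat \<Rightarrow> 'v monomial"
  assumes "finite A"
  shows "\<exists>r. strict_mono r \<and> (\<forall>i\<in>A. incseq (\<lambda>n. Poly_Mapping.lookup (s (r n)) i))"
  using assms
proof (induction A)
  case empty
  show ?case by (auto intro: strict_mono_id)
next
  case (insert i A)
  then obtain r where r: "strict_mono r" "\<forall>i\<in>A. incseq (\<lambda>n. Poly_Mapping.lookup (s (r n)) i)"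
    by blast
  obtain q where q: "strict_mono q" "incseq (\<lambda>n. Poly_Mapping.lookup (s (r (q n))) i)"
    using incseq_subseq_nat[of "\<lambda>n. Poly_Mapping.lookup (s (r n)) i"] by blast
  have "strict_mono (\<lambda>n. r (q n))"
    using r(1) q(1) by (simp add: strict_mono_def)
  moreover have "incseq (\<lambda>n. Poly_Mapping.lookup (s (r (q n))) j)" if "j \<in> A" for j
    using r(2) that strict_mono_less_eq[OF q(1)] unfolding incseq_def by blast
  ultimately show ?case
    using q(2) by (intro exI[of _ "\<lambda>n. r (q n)"]) simp
qed

text \<open>
  On a subsequence along which every exponent is nondecreasing, each term divides the next.
\<close>

lemma dickson:
  fixes s :: "nat \<Rightarrow> 'v::finite monomial"
  obtains i j where "i < j" "mon_dvd (s i) (s j)"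
proof -
  obtain r where r: "strict_mono r" "\<forall>i. incseq (\<lambda>n. Poly_Mapping.lookup (s (r n)) i)"
    using incseq_subseq_monomial[of UNIV s] by auto
  have "mon_dvd (s (r 0)) (s (r 1))"
    using r(2) by (simp add: mon_dvd_iff_lookup_le incseq_def)
  moreover have "r 0 < r 1"
    using r(1) by (simp add: strict_mono_def)
  ultimately show thesis using that by blast
qed

definition upset :: "'v monomial set \<Rightarrow> bool" where
  "upset M \<longleftrightarrow> (\<forall>s\<in>M. \<forall>t. mon_dvd s t \<longrightarrow> t \<in> M)"

lemma upsetD: "upset M \<Longrightarrow> s \<in> M \<Longrightarrow> mon_dvd s t \<Longrightarrow> t \<in> M"
  unfolding upset_def by blast

text \<open>
  The ascending chain condition for monomial ideals: monomials that witness the strict steps of an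
  ascending chain would form a sequence contradicting Dickson's lemma. The finiteness of the number
  of initial ideals is proved by induction along this relation.
\<close>

lemma wf_upset_superset: "wf {(N, M). upset N \<and> upset (M :: 'v::finite monomial set) \<and> M \<subset> N}"
  (is "wf ?R")
proof (unfold wf_iff_no_infinite_down_chain, rule notI)
  assume "\<exists>M. \<forall>i. (M (Suc i), M i) \<in> ?R"
  then obtain M where *: "\<forall>i. (M (Suc i), M i) \<in> ?R" ..
  have M: "upset (M i)" "M i \<subset> M (Suc i)" for i
    using spec[OF *, of i] by auto
  then have "\<forall>i. \<exists>s. s \<in> M (Suc i) - M i" by blast
  then obtain s where s: "\<And>i. s i \<in> M (Suc i) - M i" by metis
  obtain i j where ij: "i < j" "mon_dvd (s i) (s j)"
    by (rule dickson)
  have "M (Suc i) \<subseteq> M j"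
  proof (rule lift_Suc_mono_le)
    show "M n \<subseteq> M (Suc n)" for n using M(2) by blast
    show "Suc i \<le> j" using ij(1) by simp
  qed
  then have "s j \<in> M j"
    using s[of i] ij(2) M(1) upsetD by blast
  then show False using s[of j] by simp
qed

lemma finite_minimal_monomials:
  fixes M :: "'v::finite monomial set"
  shows "finite {m \<in> M. \<forall>s\<in>M. mon_dvd s m \<longrightarrow> s = m}" (is "finite ?A")
proof (rule ccontr)
  assume "infinite ?A"
  then obtain s :: "nat \<Rightarrow> 'v monomial" where s: "inj s" "range s \<subseteq> ?A"
    using infinite_countable_subset by blast
  obtain i j where "i < j" "mon_dvd (s i) (s j)"
    by (rule dickson)
  moreover from this s have "s i = s j" by blast
  ultimately show False using injD[OF s(1)] by blast
qed


section \<open>Monomial orders and leading monomials\<close>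

context
  fixes prec :: "'v::finite mrel"
  assumes mo: "monomial_order prec"
begin

lemma mo_irrefl: "\<not> prec s s"
  using mo by (auto simp: monomial_order_def irreflp_def)

lemma mo_trans: "prec s t \<Longrightarrow> prec t u \<Longrightarrow> prec s u"
  using mo by (auto simp: monomial_order_def transp_def)

lemma mo_asym: "prec s t \<Longrightarrow> \<not> prec t s"
  using mo_irrefl mo_trans by blast

lemma mo_total: "s \<noteq> t \<Longrightarrow> prec s t \<or> prec t s"
  using mo by (auto simp: monomial_order_def totalp_on_def)

lemma mo_add: "prec s t \<Longrightarrow> prec (u + s) (u + t)"
  using mo by (auto simp: monomial_order_def add.commute)

lemma mo_dvd:
  assumes "mon_dvd s t" shows "\<not> prec t s"
proof -
  obtain u where t: "t = s + u"
    using assms by (auto simp: mon_dvd_def)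
  show ?thesis
  proof (cases "u = 0")
    case True
    then show ?thesis using t by (simp add: mo_irrefl)
  next
    case False
    then have "prec 0 u"
      using mo by (auto simp: monomial_order_def)
    then have "prec s t"
      using mo_add[of 0 u s] t by simp
    then show ?thesis by (rule mo_asym)
  qed
qed

text \<open>
  In an infinite descending chain Dickson's lemma provides an earlier term that divides a later one,
  but a divisor is never larger than its multiple.
\<close>

lemma wfp_monomial_order: "wfp prec"
proof -
  have "False" if chain: "\<And>i. prec (s (Suc i)) (s i)" for s
  proof -
    obtain i j where ij: "i < j" "mon_dvd (s i) (s j)"
      by (rule dickson)
    have "prec (s j) (s i)"
      using ij(1)
    proof (induction j)
      case (Suc j)
      then show ?case
        by (metis chain less_antisym mo_trans)
    qed simp
    with mo_dvd[OF ij(2)] show False by blast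
  qed
  then show ?thesis
    unfolding wfp_def wf_iff_no_infinite_down_chain by blast
qed

lemma ex_max_monomial:
  assumes "finite A" "A \<noteq> {}"
  shows "\<exists>s\<in>A. \<forall>t\<in>A. t \<noteq> s \<longrightarrow> prec t s"
  using assms
proof (induction A rule: finite_ne_induct)
  case (insert a A)
  then obtain s where s: "s \<in> A" "\<forall>t\<in>A. t \<noteq> s \<longrightarrow> prec t s" by blast
  show ?case
  proof (cases "prec a s")
    case True
    with s show ?thesis by (intro bexI[of _ s]) auto
  next
    case False
    then have "prec s a"
      using mo_total[of s a] s(1) insert.hyps by auto
    with s have "prec t a" if "t \<in> A" for t
      using mo_trans[of t s a] that by (cases "t = s") auto
    then show ?thesis by (intro bexI[of _ a]) auto
  qed
qed simp

lemma lead_mon_eqI: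
  assumes "s \<in> Poly_Mapping.keys f" "\<And>t. t \<in> Poly_Mapping.keys f \<Longrightarrow> t \<noteq> s \<Longrightarrow> prec t s"
  shows "lead_mon prec f = s"
  unfolding lead_mon_def
proof (rule the_equality)
  fix s' assume s': "s' \<in> Poly_Mapping.keys f \<and> (\<forall>t\<in>Poly_Mapping.keys f. t \<noteq> s' \<longrightarrow> prec t s')"
  show "s' = s"
  proof (rule ccontr)
    assume "s' \<noteq> s"
    with s' assms have "prec s' s" "prec s s'" by auto
    then show False using mo_asym by simp
  qed
qed (use assms in auto)

lemma lead_mon:
  assumes "f \<noteq> 0"
  shows "lead_mon prec f \<in> Poly_Mapping.keys f"
    and "t \<in> Poly_Mapping.keys f \<Longrightarrow> t \<noteq> lead_mon prec f \<Longrightarrow> prec t (lead_mon prec f)"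
proof -
  obtain s where s: "s \<in> Poly_Mapping.keys f" "\<forall>t\<in>Poly_Mapping.keys f. t \<noteq> s \<longrightarrow> prec t s"
    using ex_max_monomial[of "Poly_Mapping.keys f"] assms by auto
  then have "lead_mon prec f = s"
    by (intro lead_mon_eqI) auto
  with s show "lead_mon prec f \<in> Poly_Mapping.keys f"
    and "t \<in> Poly_Mapping.keys f \<Longrightarrow> t \<noteq> lead_mon prec f \<Longrightarrow> prec t (lead_mon prec f)"
    by auto
qed

end


section \<open>Ideals and leading monomials\<close>

lemma sum_single_lookup:
  "(\<Sum>s\<in>Poly_Mapping.keys f. Poly_Mapping.single s (Poly_Mapping.lookup f s)) = f"
proof (rule poly_mapping_eqI)
  fix t
  show "Poly_Mapping.lookup (\<Sum>s\<in>Poly_Mapping.keys f. Poly_Mapping.single s (Poly_Mapping.lookup f s)) t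
    = Poly_Mapping.lookup f t"
    by (auto simp: lookup_sum lookup_single when_def in_keys_iff)
qed

lemma single_mult_lookup:
  fixes f :: "('v, 'a::field) mpoly"
  shows "Poly_Mapping.lookup (Poly_Mapping.single u c * f) (u + s) = c * Poly_Mapping.lookup f s"
    and "(\<And>s. t \<noteq> u + s) \<Longrightarrow> Poly_Mapping.lookup (Poly_Mapping.single u c * f) t = 0"
proof -
  have "Poly_Mapping.single u c * f =
      (\<Sum>s\<in>Poly_Mapping.keys f. Poly_Mapping.single (u + s) (c * Poly_Mapping.lookup f s))"
    by (subst sum_single_lookup[of f, symmetric]) (simp add: sum_distrib_left mult_single)
  then have eq: "Poly_Mapping.lookup (Poly_Mapping.single u c * f) t =
      (\<Sum>s\<in>Poly_Mapping.keys f. c * Poly_Mapping.lookup f s when u + s = t)" for t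
    by (simp add: lookup_sum lookup_single)
  show "Poly_Mapping.lookup (Poly_Mapping.single u c * f) (u + s) = c * Poly_Mapping.lookup f s"
    by (simp add: eq when_def in_keys_iff)
  show "Poly_Mapping.lookup (Poly_Mapping.single u c * f) t = 0" if "\<And>s. t \<noteq> u + s"
  proof -
    have "u + s \<noteq> t" for s using that by metis
    then show ?thesis by (simp add: eq)
  qed
qed

lemma keys_single_mult:
  fixes f :: "('v, 'a::field) mpoly"
  assumes "c \<noteq> 0"
  shows "Poly_Mapping.keys (Poly_Mapping.single u c * f) = (+) u ` Poly_Mapping.keys f"
proof (intro set_eqI)
  fix t
  show "t \<in> Poly_Mapping.keys (Poly_Mapping.single u c * f) \<longleftrightarrow> t \<in> (+) u ` Poly_Mapping.keys f"
  proof (cases "\<exists>s. t = u + s")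
    case True
    then obtain s where "t = u + s" by blast
    with assms show ?thesis
      by (auto simp: in_keys_iff single_mult_lookup(1))
  next
    case False
    then show ?thesis
      using single_mult_lookup(2)[of t u c f] by (auto simp: in_keys_iff)
  qed
qed

text \<open>
  Initial ideals are handled through their sets of exponents: \<open>leads prec I\<close> is an upset, and
  \<open>initial_ideal prec I\<close> consists of the polynomials supported on it (\<open>initial_ideal_eq\<close> below).
\<close>

definition leads :: "'v mrel \<Rightarrow> ('v, 'a::zero) mpoly set \<Rightarrow> 'v monomial set" where
  "leads prec I = lead_mon prec ` (I - {0})"

lemma leadsI: "f \<in> I \<Longrightarrow> f \<noteq> 0 \<Longrightarrow> lead_mon prec f \<in> leads prec I"
  unfolding leads_def by blast

definition monomial_ideal :: "'v monomial set \<Rightarrow> ('v, 'a::field) mpoly set" where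
  "monomial_ideal M = {p. Poly_Mapping.keys p \<subseteq> M}"

lemma subspace_monomial_ideal:
  assumes "upset M"
  shows "ideal.subspace (monomial_ideal M :: ('v, 'a::field) mpoly set)"
  unfolding ideal.subspace_def
proof (intro conjI ballI allI)
  show "0 \<in> (monomial_ideal M :: ('v, 'a) mpoly set)"
    by (simp add: monomial_ideal_def)
  show "p + q \<in> monomial_ideal M" if "p \<in> monomial_ideal M" "q \<in> monomial_ideal M"
    for p q :: "('v, 'a) mpoly"
    using that keys_add[of p q] unfolding monomial_ideal_def by blast
  show "c * p \<in> monomial_ideal M" if "p \<in> monomial_ideal M" for c p :: "('v, 'a) mpoly"
    using that keys_mult[of c p] upsetD[OF assms] mon_dvd_add(1)
    unfolding monomial_ideal_def by blast
qed

text \<open>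
  The generators may have several terms. This matters for the ideals generated by the \<open>wlt \<omega> f\<close>,
  where it suffices that enough generators are single terms and all others are supported on \<open>M\<close>.
\<close>

lemma ideal_gen_eq_monomial_ideal:
  fixes S :: "('v, 'a::field) mpoly set"
  assumes "upset M" "\<And>p. p \<in> S \<Longrightarrow> Poly_Mapping.keys p \<subseteq> M"
    and "\<And>s. s \<in> M \<Longrightarrow> \<exists>a c. c \<noteq> 0 \<and> Poly_Mapping.single a c \<in> S \<and> mon_dvd a s"
  shows "ideal_gen S = monomial_ideal M"
proof
  show "ideal_gen S \<subseteq> monomial_ideal M"
    using assms(2) by (intro ideal.span_minimal subspace_monomial_ideal assms(1))
      (auto simp: monomial_ideal_def)
  have single_mem: "Poly_Mapping.single s d \<in> ideal_gen S" if sM: "s \<in> M" for s d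
  proof -
    obtain a c where ac: "c \<noteq> 0" "Poly_Mapping.single a c \<in> S" "mon_dvd a s"
      using assms(3)[OF sM] by auto
    from ac(3) obtain u where u: "s = u + a" by (auto simp: mon_dvd_def add.commute)
    have "Poly_Mapping.single s d = Poly_Mapping.single u (d / c) * Poly_Mapping.single a c"
      using ac(1) by (simp add: mult_single u)
    then show ?thesis
      by (simp only:) (rule ideal.span_scale[OF ideal.span_base[OF ac(2)]])
  qed
  show "monomial_ideal M \<subseteq> ideal_gen S"
  proof
    fix p :: "('v, 'a) mpoly" assume "p \<in> monomial_ideal M"
    then have "(\<Sum>s\<in>Poly_Mapping.keys p. Poly_Mapping.single s (Poly_Mapping.lookup p s)) \<in> ideal_gen S"
      by (intro ideal.span_sum single_mem) (auto simp: monomial_ideal_def)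
    then show "p \<in> ideal_gen S" by (simp add: sum_single_lookup)
  qed
qed

context
  fixes prec :: "'v::finite mrel"
  assumes mo: "monomial_order prec"
begin

lemma lead_coeff_nonzero: "f \<noteq> 0 \<Longrightarrow> Poly_Mapping.lookup f (lead_mon prec f) \<noteq> 0"
  using lead_mon(1)[OF mo, of f] by (simp add: in_keys_iff)

lemma lead_mon_single_mult:
  fixes f :: "('v, 'a::field) mpoly"
  assumes "c \<noteq> 0" "f \<noteq> 0"
  shows "lead_mon prec (Poly_Mapping.single u c * f) = u + lead_mon prec f"
  using lead_mon[OF mo assms(2)] assms(1)
  by (intro lead_mon_eqI[OF mo]) (auto simp: keys_single_mult intro: mo_add[OF mo])

lemma single_mult_nonzero:
  fixes f :: "('v, 'a::field) mpoly"
  assumes "c \<noteq> 0" "f \<noteq> 0"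
  shows "Poly_Mapping.single u c * f \<noteq> 0"
proof -
  have "Poly_Mapping.keys (Poly_Mapping.single u c * f) \<noteq> {}"
    using assms by (simp add: keys_single_mult)
  then show ?thesis by force
qed

lemma upset_leads:
  fixes I :: "('v, 'a::field) mpoly set"
  assumes "ideal.subspace I"
  shows "upset (leads prec I)"
  unfolding upset_def
proof (intro ballI allI impI)
  fix s t assume "s \<in> leads prec I" "mon_dvd s t"
  then obtain f u where f: "f \<in> I" "f \<noteq> 0" "s = lead_mon prec f" "t = u + s"
    unfolding leads_def mon_dvd_def by (auto simp: add.commute)
  have "Poly_Mapping.single u 1 * f \<in> I"
    using assms f(1) by (rule ideal.subspace_scale)
  then have "lead_mon prec (Poly_Mapping.single u 1 * f) \<in> leads prec I"
    using f(2) by (intro leadsI single_mult_nonzero) auto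
  then show "t \<in> leads prec I"
    using f by (simp add: lead_mon_single_mult)
qed

lemma initial_ideal_eq:
  fixes I :: "('v, 'a::field) mpoly set"
  assumes "ideal.subspace I"
  shows "initial_ideal prec I = monomial_ideal (leads prec I)"
  unfolding initial_ideal_def
proof (rule ideal_gen_eq_monomial_ideal[OF upset_leads[OF assms]])
  fix s assume "s \<in> leads prec I"
  then obtain f where "f \<in> I - {0}" "s = lead_mon prec f"
    unfolding leads_def by blast
  then show "\<exists>a c. c \<noteq> 0 \<and> Poly_Mapping.single a c \<in> lt prec ` (I - {0}) \<and> mon_dvd a s"
    using lead_coeff_nonzero[of f]
    by (intro exI[of _ s] exI[of _ "Poly_Mapping.lookup f s"]) (auto simp: lt_def)
next
  fix p assume "p \<in> lt prec ` (I - {0})"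
  then obtain f where "f \<in> I" "f \<noteq> 0" "p = lt prec f" by blast
  then show "Poly_Mapping.keys p \<subseteq> leads prec I"
    by (simp add: lt_def leadsI)
qed

text \<open>
  A term lies in a monomial ideal if and only if one of the generating terms divides it, so the equality
  of ideals that defines a Groebner basis becomes a divisibility test for leading monomials.
\<close>

lemma is_GB_iff:
  fixes I :: "('v, 'a::field) mpoly set"
  assumes "G \<subseteq> I"
  shows "is_GB prec I G \<longleftrightarrow>
    finite G \<and> 0 \<notin> G \<and> (\<forall>f\<in>I - {0}. \<exists>g\<in>G. mon_dvd (lead_mon prec g) (lead_mon prec f))"
proof (cases "0 \<in> G")
  case False
  define M where "M = {t. \<exists>g\<in>G. mon_dvd (lead_mon prec g) t}"
  have "ideal_gen (lt prec ` G) = monomial_ideal M"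
  proof (rule ideal_gen_eq_monomial_ideal)
    show "upset M"
      unfolding upset_def M_def using mon_dvd_trans by blast
    show "Poly_Mapping.keys p \<subseteq> M" if p: "p \<in> lt prec ` G" for p
    proof -
      obtain g where "g \<in> G" "p = lt prec g" using p by blast
      then show ?thesis
        unfolding M_def by (auto simp: lt_def split: if_splits intro!: bexI[of _ g])
    qed
    fix s assume "s \<in> M"
    then obtain g where g: "g \<in> G" "mon_dvd (lead_mon prec g) s"
      by (auto simp: M_def)
    then have "g \<noteq> 0" using False by auto
    with g show "\<exists>a c. c \<noteq> 0 \<and> Poly_Mapping.single a c \<in> lt prec ` G \<and> mon_dvd a s"
      by (intro exI[of _ "lead_mon prec g"] exI[of _ "Poly_Mapping.lookup g (lead_mon prec g)"])
        (simp add: lt_def lead_coeff_nonzero)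
  qed
  moreover have "ideal_gen (lt prec ` G) \<subseteq> initial_ideal prec I"
    unfolding initial_ideal_def using assms False by (intro ideal.span_mono) auto
  ultimately have "ideal_gen (lt prec ` G) = initial_ideal prec I \<longleftrightarrow>
      lt prec ` (I - {0}) \<subseteq> (monomial_ideal M :: ('v, 'a) mpoly set)"
    using ideal.span_minimal[of "lt prec ` (I - {0})" "ideal_gen (lt prec ` G)"]
      ideal.span_superset[of "lt prec ` (I - {0})"] ideal.subspace_span[of "lt prec ` G"]
    unfolding initial_ideal_def by auto
  also have "\<dots> \<longleftrightarrow> (\<forall>f\<in>I - {0}. lead_mon prec f \<in> M)"
    by (simp add: image_subset_iff lt_def monomial_ideal_def lead_coeff_nonzero)
  finally show ?thesis
    using False assms by (simp add: is_GB_def M_def)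
qed (simp add: is_GB_def)

lemma lt_dvd_single_iff:
  fixes g :: "('v, 'a::field) mpoly"
  assumes "g \<noteq> 0"
  shows "lt prec g dvd Poly_Mapping.single s 1 \<longleftrightarrow> mon_dvd (lead_mon prec g) s"
proof
  assume "lt prec g dvd Poly_Mapping.single s 1"
  then obtain q where q: "Poly_Mapping.single s 1 = lt prec g * q" ..
  have "s \<in> Poly_Mapping.keys (lt prec g * q)"
    by (simp flip: q)
  then have "s \<in> Poly_Mapping.keys (Poly_Mapping.single (lead_mon prec g)
      (Poly_Mapping.lookup g (lead_mon prec g)) * q)"
    by (simp only: lt_def)
  then show "mon_dvd (lead_mon prec g) s"
    using lead_coeff_nonzero[OF assms] by (auto simp: keys_single_mult mon_dvd_add)
next
  assume "mon_dvd (lead_mon prec g) s"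
  then obtain u where "s = lead_mon prec g + u"
    by (auto simp: mon_dvd_def)
  then have "Poly_Mapping.single s 1 = lt prec g *
      Poly_Mapping.single u (1 / Poly_Mapping.lookup g (lead_mon prec g))"
    using lead_coeff_nonzero[OF assms] by (simp add: lt_def mult_single)
  then show "lt prec g dvd Poly_Mapping.single s 1" ..
qed

end


section \<open>Reduction modulo an ideal\<close>

text \<open>
  Multivariate division, in the form used throughout: the monomials in \<open>S\<close> are removed from \<open>f\<close>
  modulo \<open>I\<close>, always the largest one first, by subtracting a multiple of an element of \<open>I\<close> that
  has exactly this leading monomial, which exists because \<open>S\<close> consists of leading monomials
  of \<open>I\<close>. A monomial outside \<open>S\<close> that lies below no removed monomial keeps its
  coefficient.
\<close>

lemma reduction:
  fixes I :: "('v::finite, 'a::field) mpoly set"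
  assumes mo: "monomial_order prec" and I: "ideal.subspace I" and S: "S \<subseteq> leads prec I"
  shows "\<exists>g. f - g \<in> I \<and> Poly_Mapping.keys g \<inter> S = {} \<and>
    (\<forall>s. s \<notin> S \<longrightarrow> (\<forall>t\<in>Poly_Mapping.keys f \<inter> S. \<not> prec s t) \<longrightarrow>
      Poly_Mapping.lookup g s = Poly_Mapping.lookup f s)"
proof -
  have main: "\<forall>f :: ('v, 'a) mpoly. (\<forall>t\<in>Poly_Mapping.keys f \<inter> S. prec t m) \<longrightarrow>
    (\<exists>g. f - g \<in> I \<and> Poly_Mapping.keys g \<inter> S = {} \<and>
      (\<forall>s. s \<notin> S \<longrightarrow> (\<forall>t\<in>Poly_Mapping.keys f \<inter> S. \<not> prec s t) \<longrightarrow>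
        Poly_Mapping.lookup g s = Poly_Mapping.lookup f s))" (is "\<forall>f. _ f \<longrightarrow> ?P f") for m
  proof (induction m rule: wfp_induct_rule[OF wfp_monomial_order[OF mo]])
    case (1 m)
    show ?case
    proof (intro allI impI)
      fix f :: "('v, 'a) mpoly" assume below: "\<forall>t\<in>Poly_Mapping.keys f \<inter> S. prec t m"
      show "?P f"
      proof (cases "Poly_Mapping.keys f \<inter> S = {}")
        case True
        then show ?thesis
          using ideal.subspace_0[OF I] by (intro exI[of _ f]) simp
      next
        case False
        then obtain t where t: "t \<in> Poly_Mapping.keys f" "t \<in> S"
          and t_max: "\<And>s. s \<in> Poly_Mapping.keys f \<Longrightarrow> s \<in> S \<Longrightarrow> s \<noteq> t \<Longrightarrow> prec s t"
          using ex_max_monomial[OF mo, of "Poly_Mapping.keys f \<inter> S"] by auto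
        obtain h where h: "h \<in> I" "h \<noteq> 0" "t = lead_mon prec h"
          using S t(2) unfolding leads_def by blast
        have h_below: "prec s t" if "s \<in> Poly_Mapping.keys h" "s \<noteq> t" for s
          using lead_mon(2)[OF mo h(2)] that h(3) by simp
        define c where "c = Poly_Mapping.lookup f t / Poly_Mapping.lookup h t"
        define f' where "f' = f - Poly_Mapping.single 0 c * h"
        have lookup_f': "Poly_Mapping.lookup f' s = Poly_Mapping.lookup f s - c * Poly_Mapping.lookup h s" for s
          using single_mult_lookup(1)[of 0 c h s] by (simp add: f'_def lookup_minus)
        have t_f': "t \<notin> Poly_Mapping.keys f'"
          using lead_coeff_nonzero[OF mo h(2)] h(3) by (simp add: in_keys_iff lookup_f' c_def)
        have below': "prec s t" if "s \<in> Poly_Mapping.keys f'" "s \<in> S" for s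
        proof -
          have "s \<noteq> t" using that t_f' by blast
          moreover have "s \<in> Poly_Mapping.keys f \<or> s \<in> Poly_Mapping.keys h"
            using that(1) by (auto simp: in_keys_iff lookup_f')
          ultimately show ?thesis
            using t_max h_below that(2) by blast
        qed
        have "prec t m" using below t by simp
        from "1.IH"[OF this] below' have "?P f'" by auto
        then obtain g where g: "f' - g \<in> I" "Poly_Mapping.keys g \<inter> S = {}"
          and keep: "\<And>s. s \<notin> S \<Longrightarrow> (\<forall>t\<in>Poly_Mapping.keys f' \<inter> S. \<not> prec s t) \<Longrightarrow>
            Poly_Mapping.lookup g s = Poly_Mapping.lookup f' s"
          by auto
        have "Poly_Mapping.single 0 c * h + (f' - g) \<in> I"
          using g(1) h(1) by (intro ideal.subspace_add[OF I] ideal.subspace_scale[OF I])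
        then have "f - g \<in> I"
          by (simp add: f'_def)
        moreover have "Poly_Mapping.lookup g s = Poly_Mapping.lookup f s"
          if "s \<notin> S" "\<forall>t\<in>Poly_Mapping.keys f \<inter> S. \<not> prec s t" for s
        proof -
          have st: "\<not> prec s t" "s \<noteq> t" using that t by auto
          then have "Poly_Mapping.lookup h s = 0"
            using h_below by (auto simp: in_keys_iff)
          moreover have "Poly_Mapping.lookup g s = Poly_Mapping.lookup f' s"
            using below' mo_trans[OF mo] st(1) by (intro keep that(1)) blast
          ultimately show ?thesis
            by (simp add: lookup_f')
        qed
        ultimately show ?thesis
          using g(2) by (intro exI[of _ g]) simp
      qed
    qed
  qed
  obtain m where "\<forall>t\<in>Poly_Mapping.keys f \<inter> S. prec t m"
  proof (cases "Poly_Mapping.keys f \<inter> S = {}")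
    case True
    then show thesis using that by auto
  next
    case False
    then obtain t where t: "\<forall>s\<in>Poly_Mapping.keys f \<inter> S. s \<noteq> t \<longrightarrow> prec s t"
      using ex_max_monomial[OF mo, of "Poly_Mapping.keys f \<inter> S"] by auto
    (* Any variable will do to produce a monomial above t. *)
    define e :: "'v monomial" where "e = Poly_Mapping.single undefined 1"
    have "e \<noteq> 0"
      by (metis e_def lookup_single_eq lookup_zero one_neq_zero)
    then have "prec 0 e"
      using mo by (simp add: monomial_order_def)
    from mo_add[OF mo this, of t] have "prec t (t + e)" by simp
    with t have "\<forall>s\<in>Poly_Mapping.keys f \<inter> S. prec s (t + e)"
      using mo_trans[OF mo] by metis
    then show thesis by (rule that)
  qed
  with main show ?thesis by blast
qed

text \<open>
  The leading monomial \<open>m\<close> survives the reduction because it lies outside \<open>S\<close> and all removed monomials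
  are smaller. The three uses differ in the choice of \<open>S\<close>: all leading monomials but \<open>m\<close> (elements of
  the reduced Groebner basis), the leading monomials for another order (\<open>leads_subset_imp_eq\<close>), and
  a monomial ideal strictly contained in the initial ideal (\<open>finite_leads_above\<close>).
\<close>

lemma reduced_element:
  fixes I :: "('v::finite, 'a::field) mpoly set"
  assumes mo: "monomial_order prec" and I: "ideal.subspace I" and S: "S \<subseteq> leads prec I"
    and m: "m \<in> leads prec I" "m \<notin> S"
  obtains g where "g \<in> I" "g \<noteq> 0" "lead_mon prec g = m" "Poly_Mapping.lookup g m = 1"
    "Poly_Mapping.keys g \<inter> S = {}"
proof -
  obtain f where f: "f \<in> I" "f \<noteq> 0" "m = lead_mon prec f"
    using m(1) unfolding leads_def by blast
  have f_below: "s = m \<or> prec s m" if "s \<in> Poly_Mapping.keys f" for s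
    using lead_mon(2)[OF mo f(2) that] f(3) by blast
  obtain g where g: "f - g \<in> I" "Poly_Mapping.keys g \<inter> S = {}"
    and keep: "\<And>s. s \<notin> S \<Longrightarrow> (\<forall>t\<in>Poly_Mapping.keys f \<inter> S. \<not> prec s t) \<Longrightarrow>
      Poly_Mapping.lookup g s = Poly_Mapping.lookup f s"
    using reduction[OF mo I S, of f] by auto
  define c where "c = Poly_Mapping.lookup f m"
  have c: "c \<noteq> 0" using lead_coeff_nonzero[OF mo f(2)] f(3) by (simp add: c_def)
  have above: "\<forall>t\<in>Poly_Mapping.keys f \<inter> S. \<not> prec s t" if "s = m \<or> prec m s" for s
    using f_below that mo_asym[OF mo] mo_trans[OF mo] by blast
  have gm: "Poly_Mapping.lookup g m = c"
    using keep[OF m(2) above] by (simp add: c_def)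
  have g_below: "prec s m" if s: "s \<in> Poly_Mapping.keys g" "s \<noteq> m" for s
  proof (rule ccontr)
    assume "\<not> prec s m"
    then have ms: "prec m s" using mo_total[OF mo s(2)] by blast
    have "s \<notin> S" using g(2) s(1) by blast
    then have "Poly_Mapping.lookup f s = Poly_Mapping.lookup g s"
      using keep above ms by simp
    then have "s \<in> Poly_Mapping.keys f" using s(1) by (simp add: in_keys_iff)
    then show False using f_below s(2) \<open>\<not> prec s m\<close> by blast
  qed
  define h where "h = Poly_Mapping.single 0 (1 / c) * g"
  have keys_h: "Poly_Mapping.keys h = Poly_Mapping.keys g"
    using c by (simp add: h_def keys_single_mult)
  have hm: "Poly_Mapping.lookup h m = 1"
    using single_mult_lookup(1)[of 0 "1 / c" g m] c gm by (simp add: h_def)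
  have "g \<in> I"
    using ideal.subspace_diff[OF I f(1) g(1)] by simp
  then have "h \<in> I"
    unfolding h_def by (rule ideal.subspace_scale[OF I])
  moreover have "lead_mon prec h = m"
    using hm g_below by (intro lead_mon_eqI[OF mo]) (simp_all add: in_keys_iff flip: keys_h)
  moreover have "h \<noteq> 0" using hm by force
  ultimately show thesis
    using that hm keys_h g(2) by simp
qed

text \<open>
  If the inclusion were strict, \<open>I\<close> would contain a nonzero element without any monomial in
  \<open>leads prec I\<close>, but its own leading monomial for \<open>prec\<close> belongs to that set.
\<close>

lemma leads_subset_imp_eq:
  fixes I :: "('v::finite, 'a::field) mpoly set"
  assumes mo: "monomial_order prec" "monomial_order prec'" and I: "ideal.subspace I"
    and sub: "leads prec I \<subseteq> leads prec' I"
  shows "leads prec I = leads prec' I"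
proof (rule ccontr)
  assume "leads prec I \<noteq> leads prec' I"
  then obtain m where "m \<in> leads prec' I" "m \<notin> leads prec I"
    using sub by blast
  then obtain g where "g \<in> I" "g \<noteq> 0" "Poly_Mapping.keys g \<inter> leads prec I = {}"
    by (rule reduced_element[OF mo(2) I sub])
  then show False
    using leadsI[of g I prec] lead_mon(1)[OF mo(1)] by blast
qed


section \<open>Reduced Groebner bases\<close>

lemma is_reduced_GB_iff:
  fixes I :: "('v::finite, 'a::field) mpoly set"
  assumes mo: "monomial_order prec"
  shows "is_reduced_GB prec I G \<longleftrightarrow> G \<subseteq> I \<and> finite G \<and> 0 \<notin> G \<and>
    (\<forall>f\<in>I - {0}. \<exists>g\<in>G. mon_dvd (lead_mon prec g) (lead_mon prec f)) \<and>
    (\<forall>g\<in>G. \<forall>h\<in>G. g \<noteq> h \<longrightarrow> (\<forall>s\<in>Poly_Mapping.keys h. \<not> mon_dvd (lead_mon prec g) s)) \<and>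
    (\<forall>g\<in>G. Poly_Mapping.lookup g (lead_mon prec g) = 1)" (is "_ \<longleftrightarrow> ?R")
proof (cases "G \<subseteq> I \<and> 0 \<notin> G")
  case True
  then have "\<And>g s. g \<in> G \<Longrightarrow> lt prec g dvd Poly_Mapping.single s 1 \<longleftrightarrow> mon_dvd (lead_mon prec g) s"
    by (intro lt_dvd_single_iff[OF mo]) auto
  then show ?thesis
    using True is_GB_iff[OF mo, of G I] by (simp add: is_reduced_GB_def lc_def)
next
  case False
  then show ?thesis
    by (auto simp: is_reduced_GB_def is_GB_def)
qed

text \<open>
  A leading monomial of \<open>I\<close> that occurs in \<open>g\<close> is divisible by the leading monomial of some basis
  element, which must be \<open>g\<close> itself by reducedness, and the other monomials of \<open>g\<close> are too small
  for that. So the tail of \<open>g\<close> consists of standard monomials, those outside the initial ideal.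
\<close>

lemma reduced_GB_key_in_leads:
  fixes I :: "('v::finite, 'a::field) mpoly set"
  assumes mo: "monomial_order prec" and G: "is_reduced_GB prec I G"
    and g: "g \<in> G" "s \<in> Poly_Mapping.keys g" "s \<in> leads prec I"
  shows "s = lead_mon prec g"
proof -
  note G' = G[unfolded is_reduced_GB_iff[OF mo]]
  obtain f where "f \<in> I - {0}" "s = lead_mon prec f"
    using g(3) unfolding leads_def by blast
  then obtain h where h: "h \<in> G" "mon_dvd (lead_mon prec h) s"
    using G' by blast
  then have "h = g"
    using G' g(1,2) by blast
  then show ?thesis
    using lead_mon(2)[OF mo, of g s] g(1,2) G' mo_dvd[OF mo h(2)] by auto
qed

text \<open>
  The leading monomials are the minimal generators of the initial ideal, which are finitely many by
  Dickson's lemma; for each of them \<open>reduced_element\<close> provides an element whose tail avoids the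
  initial ideal.
\<close>

lemma ex_reduced_GB:
  fixes I :: "('v::finite, 'a::field) mpoly set"
  assumes mo: "monomial_order prec" and I: "ideal.subspace I"
  shows "\<exists>G. is_reduced_GB prec I G"
proof -
  define L where "L = leads prec I"
  define A where "A = {m \<in> L. \<forall>s\<in>L. mon_dvd s m \<longrightarrow> s = m}"
  have "\<forall>m\<in>L. \<exists>g. g \<in> I \<and> g \<noteq> 0 \<and> lead_mon prec g = m \<and> Poly_Mapping.lookup g m = 1 \<and>
      Poly_Mapping.keys g \<inter> (L - {m}) = {}"
  proof
    fix m assume m: "m \<in> L"
    obtain g where "g \<in> I" "g \<noteq> 0" "lead_mon prec g = m" "Poly_Mapping.lookup g m = 1"
      "Poly_Mapping.keys g \<inter> (L - {m}) = {}"
      by (rule reduced_element[OF mo I, of "L - {m}" m]) (use m in \<open>auto simp: L_def\<close>)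
    then show "\<exists>g. g \<in> I \<and> g \<noteq> 0 \<and> lead_mon prec g = m \<and> Poly_Mapping.lookup g m = 1 \<and>
      Poly_Mapping.keys g \<inter> (L - {m}) = {}" by blast
  qed
  from bchoice[OF this] obtain b where b: "\<And>m. m \<in> L \<Longrightarrow> b m \<in> I" "\<And>m. m \<in> L \<Longrightarrow> b m \<noteq> 0"
    "\<And>m. m \<in> L \<Longrightarrow> lead_mon prec (b m) = m" "\<And>m. m \<in> L \<Longrightarrow> Poly_Mapping.lookup (b m) m = 1"
    "\<And>m. m \<in> L \<Longrightarrow> Poly_Mapping.keys (b m) \<inter> (L - {m}) = {}"
    by auto
  have AL: "A \<subseteq> L" by (auto simp: A_def)
  have "finite A"
    unfolding A_def by (rule finite_minimal_monomials)
  moreover have min_below: "\<exists>m\<in>A. mon_dvd m s" if "s \<in> L" for s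
    using that
  proof (induction s rule: wfp_induct_rule[OF wfp_monomial_order[OF mo]])
    case (1 s)
    show ?case
    proof (cases "s \<in> A")
      case False
      then obtain r where r: "r \<in> L" "mon_dvd r s" "r \<noteq> s"
        using "1.prems" by (auto simp: A_def)
      then have "prec r s"
        using mo_total[OF mo] mo_dvd[OF mo] by blast
      then show ?thesis
        using "1.IH" r mon_dvd_trans by blast
    qed (use mon_dvd_refl in blast)
  qed
  moreover have tails: "\<not> mon_dvd m s" if "m \<in> A" "k \<in> A" "m \<noteq> k" "s \<in> Poly_Mapping.keys (b k)" for m k s
  proof
    assume ms: "mon_dvd m s"
    then have "s \<in> L"
      using upsetD[OF upset_leads[OF mo I]] that(1) AL unfolding L_def by blast
    then have "s = k"
      using b(5) that(2,4) AL by blast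
    then show False
      using ms that(1-3) AL by (auto simp: A_def)
  qed
  moreover have "b ` A \<subseteq> I" "0 \<notin> b ` A"
    using b(1) b(2) AL by force+
  moreover have lead_b: "lead_mon prec (b m) = m" "Poly_Mapping.lookup (b m) m = 1" if "m \<in> A" for m
    using b(3,4) AL that by auto
  moreover have "\<exists>g\<in>b ` A. mon_dvd (lead_mon prec g) (lead_mon prec f)" if "f \<in> I - {0}" for f
  proof -
    have "lead_mon prec f \<in> L"
      using that leadsI[of f I prec] by (simp add: L_def)
    then obtain m where "m \<in> A" "mon_dvd m (lead_mon prec f)"
      using min_below by blast
    then show ?thesis by (auto simp: lead_b intro!: bexI[of _ m])
  qed
  moreover have "\<not> mon_dvd (lead_mon prec g) s"
    if "g \<in> b ` A" "h \<in> b ` A" "g \<noteq> h" "s \<in> Poly_Mapping.keys h" for g h s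
    using that tails lead_b(1) by force
  ultimately have "is_reduced_GB prec I (b ` A)"
    unfolding is_reduced_GB_iff[OF mo] by simp
  then show ?thesis ..
qed

text \<open>
  An element \<open>g\<close> of one basis shares its leading monomial with some \<open>h\<close> of the other. Both are monic,
  so the leading term cancels in \<open>g - h\<close>; what is left is supported on standard monomials and lies
  in the ideal, hence vanishes.
\<close>

lemma reduced_GB_subset:
  fixes I :: "('v::finite, 'a::field) mpoly set"
  assumes mo: "monomial_order prec" and I: "ideal.subspace I"
    and G: "is_reduced_GB prec I G" and H: "is_reduced_GB prec I H"
  shows "G \<subseteq> H"
proof
  fix g assume g: "g \<in> G"
  note G' = G[unfolded is_reduced_GB_iff[OF mo]] and H' = H[unfolded is_reduced_GB_iff[OF mo]]
  from g have g0: "g \<in> I" "g \<noteq> 0" using G' by auto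
  then obtain h where h: "h \<in> H" "mon_dvd (lead_mon prec h) (lead_mon prec g)"
    using H' by blast
  then have h0: "h \<in> I" "h \<noteq> 0" using H' by auto
  then have "lead_mon prec h \<in> leads prec I" by (rule leadsI)
  obtain k where k: "k \<in> G" "mon_dvd (lead_mon prec k) (lead_mon prec h)"
    using G' h0 by blast
  have "mon_dvd (lead_mon prec k) (lead_mon prec g)"
    using k(2) h(2) by (rule mon_dvd_trans)
  then have "k = g"
    using G' g k(1) lead_mon(1)[OF mo g0(2)] by blast
  then have eq: "lead_mon prec g = lead_mon prec h"
    using h(2) k(2) mo_dvd[OF mo] mo_total[OF mo] by blast
  show "g \<in> H"
  proof (cases "g = h")
    case False
    let ?s = "lead_mon prec (g - h)"
    have "g - h \<in> I" "g - h \<noteq> 0"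
      using ideal.subspace_diff[OF I g0(1) h0(1)] False by auto
    then have s: "?s \<in> Poly_Mapping.keys (g - h)" "?s \<in> leads prec I"
      using lead_mon(1)[OF mo] leadsI by blast+
    have "?s \<noteq> lead_mon prec g"
      using s(1) G' H' g h(1) eq by (auto simp: in_keys_iff lookup_minus)
    moreover have "?s \<in> Poly_Mapping.keys g \<or> ?s \<in> Poly_Mapping.keys h"
      using s(1) by (auto simp: in_keys_iff lookup_minus)
    ultimately show ?thesis
      using reduced_GB_key_in_leads[OF mo G g _ s(2)] reduced_GB_key_in_leads[OF mo H h(1) _ s(2)] eq
      by auto
  qed (use h in simp)
qed

lemma is_reduced_GB_GB:
  fixes I :: "('v::finite, 'a::field) mpoly set"
  assumes mo: "monomial_order prec" and I: "ideal.subspace I"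
  shows "is_reduced_GB prec I (GB I prec)"
  unfolding GB_def
proof (rule theI')
  show "\<exists>!G. is_reduced_GB prec I G"
    using ex_reduced_GB[OF mo I] reduced_GB_subset[OF mo I] by (metis subset_antisym)
qed


section \<open>An ideal has finitely many initial ideals\<close>

text \<open>
  Noetherian induction on the monomial ideal \<open>M\<close>. If some initial ideal is strictly larger than \<open>M\<close>,
  then \<open>I\<close> contains a nonzero \<open>g\<close> without monomials in \<open>M\<close>. For every order, the leading monomial of
  \<open>g\<close> is one of the finitely many monomials of \<open>g\<close>, so each initial ideal above \<open>M\<close> lies above one of
  finitely many strictly larger monomial ideals.
\<close>

lemma finite_leads_above:
  fixes I :: "('v::finite, 'a::field) mpoly set"
  assumes I: "ideal.subspace I" and M: "upset M"
  shows "finite {leads prec I |prec. monomial_order prec \<and> M \<subseteq> leads prec I}"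
  using M
proof (induction M rule: wf_induct_rule[OF wf_upset_superset])
  case (1 M)
  show ?case (is "finite ?F")
  proof (cases "\<exists>prec. monomial_order prec \<and> M \<subset> leads prec I")
    case False
    then have "?F \<subseteq> {M}" by auto
    then show ?thesis by (rule finite_subset) simp
  next
    case True
    then obtain prec where prec: "monomial_order prec" "M \<subseteq> leads prec I" "M \<noteq> leads prec I"
      by blast
    then obtain m where "m \<in> leads prec I" "m \<notin> M" by blast
    then obtain g where g: "g \<in> I" "g \<noteq> 0" "Poly_Mapping.keys g \<inter> M = {}"
      by (rule reduced_element[OF prec(1) I prec(2)])
    define N where "N s = M \<union> {t. mon_dvd s t}" for s
    define F where "F K = {leads prec I |prec. monomial_order prec \<and> K \<subseteq> leads prec I}" for K
    have "finite (F (N s))" if "s \<in> Poly_Mapping.keys g" for s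
    proof -
      have "upset (N s)"
        using "1.prems" mon_dvd_trans unfolding upset_def N_def by blast
      moreover have "M \<subset> N s"
        using that g(3) mon_dvd_refl[of s] unfolding N_def by blast
      ultimately show ?thesis
        unfolding F_def using "1.IH"[of "N s"] "1.prems" by simp
    qed
    then have "finite (\<Union>s\<in>Poly_Mapping.keys g. F (N s))" by simp
    moreover have "?F \<subseteq> (\<Union>s\<in>Poly_Mapping.keys g. F (N s))"
    proof
      fix L assume "L \<in> ?F"
      then obtain p where p: "L = leads p I" "monomial_order p" "M \<subseteq> leads p I" by blast
      have s: "lead_mon p g \<in> Poly_Mapping.keys g" "lead_mon p g \<in> leads p I"
        using lead_mon(1)[OF p(2) g(2)] leadsI[OF g(1,2)] by auto
      then have "N (lead_mon p g) \<subseteq> leads p I"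
        using p(3) upsetD[OF upset_leads[OF p(2) I]] unfolding N_def by blast
      then have "L \<in> F (N (lead_mon p g))"
        unfolding F_def using p by blast
      with s(1) show "L \<in> (\<Union>s\<in>Poly_Mapping.keys g. F (N s))" by blast
    qed
    ultimately show ?thesis by (rule rev_finite_subset)
  qed
qed

lemma finite_leads:
  fixes I :: "('v::finite, 'a::field) mpoly set"
  assumes "ideal.subspace I"
  shows "finite {leads prec I |prec. monomial_order prec}"
  using finite_leads_above[OF assms, of "{}"] by (simp add: upset_def)


section \<open>Weights representing a monomial order on finitely many comparisons\<close>

lemma ex_between_finite_sets:
  fixes L U :: "real set"
  assumes "finite L" "finite U" "\<And>l u. l \<in> L \<Longrightarrow> u \<in> U \<Longrightarrow> l < u"
  shows "\<exists>x. (\<forall>l\<in>L. l < x) \<and> (\<forall>u\<in>U. x < u)"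
proof (cases "L = {} \<or> U = {}")
  case True
  have "\<forall>u\<in>U. Min (insert 0 U) - 1 < u"
    using assms(2) by (metis Min_le diff_less_eq finite_insert insertI2 less_add_one order_le_less_trans)
  moreover have "\<forall>l\<in>L. l < Max (insert 0 L) + 1"
    using assms(1) by (metis Max_ge finite_insert insertI2 less_add_one order_le_less_trans)
  ultimately show ?thesis using True by auto
next
  case False
  then have "Max L < Min U"
    using assms by simp
  then obtain x where "Max L < x" "x < Min U" using dense by blast
  with assms False show ?thesis by auto
qed

text \<open>
  A finite set \<open>D\<close> of integer vectors inside an additive semigroup \<open>P\<close> that omits the origin is
  strictly positive for some real linear form. The proof eliminates one coordinate \<open>j\<close> at a time: the
  positive combinations of vectors of \<open>D\<close> in which coordinate \<open>j\<close> cancels stay in \<open>P\<close>, a linear form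
  positive on them exists by induction, and their positivity says that the lower bounds on the missing
  coefficient of \<open>j\<close> lie below the upper bounds. The coefficients are integers, so closure of \<open>P\<close>
  under addition is enough.
\<close>

lemma fourier_motzkin:
  fixes P :: "('v \<Rightarrow> int) set"
  assumes P_add: "\<And>p q. p \<in> P \<Longrightarrow> q \<in> P \<Longrightarrow> (\<lambda>i. p i + q i) \<in> P" and zero: "(\<lambda>_. 0) \<notin> P"
    and "finite A" "finite D" "D \<subseteq> P" "\<And>d i. d \<in> D \<Longrightarrow> i \<notin> A \<Longrightarrow> d i = 0"
  shows "\<exists>w :: 'v \<Rightarrow> real. \<forall>d\<in>D. 0 < (\<Sum>i\<in>A. w i * of_int (d i))"
  using assms(3-)
proof (induction A arbitrary: D rule: finite_induct)
  case empty
  have "d \<notin> D" for d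
  proof
    assume d: "d \<in> D"
    then have "d = (\<lambda>_. 0)" using empty.prems(3)[OF d] by auto
    then show False using d empty.prems(2) zero by blast
  qed
  then show ?case by blast
next
  case (insert j A)
  have P_scale_nat: "(\<lambda>i. int (Suc n) * p i) \<in> P" if "p \<in> P" for p n
  proof (induction n)
    case (Suc n)
    from P_add[OF this that] show ?case by (simp add: algebra_simps)
  qed (use that in simp)
  have P_scale: "(\<lambda>i. c * p i) \<in> P" if "p \<in> P" "0 < c" for p and c :: int
    using P_scale_nat[OF that(1), of "nat (c - 1)"] that(2) by simp
  define comb where "comb d e = (\<lambda>i. d j * e i - e j * d i)" for d e :: "'v \<Rightarrow> int"
  define Dp where "Dp = {d \<in> D. d j > 0}"
  define Dn where "Dn = {d \<in> D. d j < 0}"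
  (* D' has coordinate j eliminated: the combinations cancel it with positive coefficients. *)
  define D' where "D' = {d \<in> D. d j = 0} \<union> (\<lambda>(d, e). comb d e) ` (Dp \<times> Dn)"
  have fin: "finite Dp" "finite Dn"
    using insert.prems(1) by (auto simp: Dp_def Dn_def)
  have comb_P: "comb d e \<in> P" if "d \<in> Dp" "e \<in> Dn" for d e
  proof -
    have "(\<lambda>i. d j * e i) \<in> P" "(\<lambda>i. (- e j) * d i) \<in> P"
      using P_scale[of e "d j"] P_scale[of d "- e j"] that insert.prems(2) by (auto simp: Dp_def Dn_def)
    from P_add[OF this] show ?thesis by (simp add: comb_def)
  qed
  have "\<exists>w :: 'v \<Rightarrow> real. \<forall>d\<in>D'. 0 < (\<Sum>i\<in>A. w i * of_int (d i))"
  proof (rule insert.IH)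
    show "finite D'"
      using insert.prems(1) fin by (simp add: D'_def)
    show "D' \<subseteq> P"
      using insert.prems(2) comb_P by (auto simp: D'_def)
    show "d i = 0" if dD': "d \<in> D'" "i \<notin> A" for d i
    proof (cases "i = j")
      case True
      then show ?thesis using that(1) by (auto simp: D'_def comb_def)
    next
      case False
      then have vanish: "a i = 0" if "a \<in> D" for a
        using insert.prems(3)[OF that, of i] \<open>i \<notin> A\<close> by simp
      consider "d \<in> D" | a b where "a \<in> D" "b \<in> D" "d = comb a b"
        using dD'(1) by (auto simp: D'_def Dp_def Dn_def)
      then show ?thesis
        by cases (simp_all add: comb_def vanish)
    qed
  qed
  then obtain w :: "'v \<Rightarrow> real" where w: "\<And>d. d \<in> D' \<Longrightarrow> 0 < (\<Sum>i\<in>A. w i * of_int (d i))"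
    by blast
  define dot where "dot d = (\<Sum>i\<in>A. w i * of_int (d i))" for d :: "'v \<Rightarrow> int"
  have "\<exists>x. (\<forall>l\<in>(\<lambda>d. - dot d / of_int (d j)) ` Dp. l < x) \<and>
      (\<forall>u\<in>(\<lambda>e. - dot e / of_int (e j)) ` Dn. x < u)"
  proof (rule ex_between_finite_sets)
    fix l u assume "l \<in> (\<lambda>d. - dot d / of_int (d j)) ` Dp" "u \<in> (\<lambda>e. - dot e / of_int (e j)) ` Dn"
    then obtain d e where de: "d \<in> Dp" "e \<in> Dn"
      "l = - dot d / of_int (d j)" "u = - dot e / of_int (e j)" by blast
    have "comb d e \<in> D'" using de by (auto simp: D'_def)
    then have "0 < dot (comb d e)" unfolding dot_def by (rule w)
    also have "dot (comb d e) = of_int (d j) * dot e - of_int (e j) * dot d"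
      unfolding dot_def comb_def sum_distrib_left sum_subtractf[symmetric]
      by (intro sum.cong) (simp_all add: algebra_simps)
    finally have "0 < of_int (d j) * dot e - of_int (e j) * dot d" .
    moreover have "(0::real) < of_int (d j)" "of_int (e j) < (0::real)"
      using de by (auto simp: Dp_def Dn_def)
    ultimately show "l < u"
      unfolding de by (simp add: field_simps)
  qed (use fin in auto)
  then obtain x where x: "\<And>d. d \<in> Dp \<Longrightarrow> - dot d / of_int (d j) < x"
    "\<And>d. d \<in> Dn \<Longrightarrow> x < - dot d / of_int (d j)" by blast
  have "0 < (\<Sum>i\<in>insert j A. (w(j := x)) i * of_int (d i))" if d: "d \<in> D" for d
  proof -
    have "(\<Sum>i\<in>A. (w(j := x)) i * of_int (d i)) = dot d"
      unfolding dot_def using insert.hyps(2) by (intro sum.cong) auto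
    then have "(\<Sum>i\<in>insert j A. (w(j := x)) i * of_int (d i)) = x * of_int (d j) + dot d"
      using insert.hyps by simp
    moreover have "0 < x * of_int (d j) + dot d"
    proof (cases "d j" "0 :: int" rule: linorder_cases)
      case less
      then show ?thesis using x(2)[of d] d by (simp add: Dn_def field_simps)
    next
      case equal
      then show ?thesis using w[of d] d by (simp add: D'_def dot_def)
    next
      case greater
      then show ?thesis using x(1)[of d] d by (simp add: Dp_def field_simps)
    qed
    ultimately show ?thesis by simp
  qed
  then show ?case by blast
qed

lemma mon_wdeg_add: "mon_wdeg \<omega> (s + t) = mon_wdeg \<omega> s + mon_wdeg \<omega> t"
  by (simp add: mon_wdeg_def lookup_add sum.distrib algebra_simps)

lemma mon_wdeg_weight_add: "mon_wdeg (\<omega> + \<omega>') s = mon_wdeg \<omega> s + mon_wdeg \<omega>' s"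
  by (simp add: mon_wdeg_def sum.distrib algebra_simps)

lemma mon_wdeg_weight_scale: "mon_wdeg (c *\<^sub>R \<omega>) s = c * mon_wdeg \<omega> s"
  by (simp add: mon_wdeg_def sum_distrib_left algebra_simps)

lemma mon_wdeg_nonneg: "\<omega> \<in> weights \<Longrightarrow> 0 \<le> mon_wdeg \<omega> s"
  by (simp add: mon_wdeg_def weights_def sum_nonneg)

lemma continuous_on_mon_wdeg [continuous_intros]: "continuous_on A (\<lambda>\<omega>. mon_wdeg \<omega> s)"
  unfolding mon_wdeg_def by (intro continuous_intros)

text \<open>
  The differences \<open>t - s\<close> with \<open>prec s t\<close> form a semigroup that omits the origin. Adding the
  comparisons of \<open>1\<close> with the variables makes the resulting weights nonnegative.
\<close>

lemma ex_weight_for_comparisons: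
  fixes B :: "('v::finite monomial \<times> 'v monomial) set"
  assumes mo: "monomial_order prec" and fin: "finite B"
    and B: "\<And>s t. (s, t) \<in> B \<Longrightarrow> prec s t"
  shows "\<exists>\<omega>\<in>weights. \<forall>(s, t)\<in>B. mon_wdeg \<omega> s < mon_wdeg \<omega> t"
proof -
  define diff where "diff = (\<lambda>(s, t) i. int (Poly_Mapping.lookup t i) - int (Poly_Mapping.lookup (s :: 'v monomial) i))"
  define P where "P = diff ` {(s, t). prec s t}"
  define C where "C = B \<union> range (\<lambda>i. (0, Poly_Mapping.single i 1))"
  have C: "prec s t" if "(s, t) \<in> C" for s t
  proof (cases "(s, t) \<in> B")
    case False
    then obtain i where st: "s = 0" "t = Poly_Mapping.single i 1"
      using \<open>(s, t) \<in> C\<close> by (auto simp: C_def)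
    have "Poly_Mapping.lookup t i \<noteq> 0" by (simp add: st)
    then have "t \<noteq> 0" by force
    then show ?thesis using mo st(1) by (simp add: monomial_order_def)
  qed (rule B)
  have "\<exists>w :: 'v \<Rightarrow> real. \<forall>d\<in>diff ` C. 0 < (\<Sum>i\<in>UNIV. w i * of_int (d i))"
  proof (rule fourier_motzkin)
    show "(\<lambda>i. p i + q i) \<in> P" if "p \<in> P" "q \<in> P" for p q
    proof -
      obtain s t s' t' where st: "prec s t" "p = diff (s, t)" "prec s' t'" "q = diff (s', t')"
        using \<open>p \<in> P\<close> \<open>q \<in> P\<close> by (auto simp: P_def)
      have "prec (s + s') (s + t')" "prec (s + t') (t + t')"
        using mo_add[OF mo st(3), of s] mo_add[OF mo st(1), of t'] by (simp_all add: add.commute)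
      then have "prec (s + s') (t + t')" by (rule mo_trans[OF mo])
      moreover have "(\<lambda>i. p i + q i) = diff (s + s', t + t')"
        by (simp add: st diff_def lookup_add fun_eq_iff)
      ultimately show ?thesis
        unfolding P_def by blast
    qed
    show "(\<lambda>_. 0) \<notin> P"
    proof
      assume "(\<lambda>_. 0) \<in> P"
      then obtain s t where st: "prec s t" "(\<lambda>_. 0) = diff (s, t)" by (auto simp: P_def)
      have "Poly_Mapping.lookup t i = Poly_Mapping.lookup s i" for i
        using fun_cong[OF st(2), of i] by (simp add: diff_def)
      then have "s = t" by (simp add: poly_mapping_eqI)
      then show False using st(1) mo_irrefl[OF mo] by blast
    qed
    show "finite (diff ` C)" using fin by (simp add: C_def)
    show "diff ` C \<subseteq> P" using C by (auto simp: P_def)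
  qed auto
  then obtain w :: "'v \<Rightarrow> real" where w: "\<And>c. c \<in> C \<Longrightarrow> 0 < (\<Sum>i\<in>UNIV. w i * of_int (diff c i))"
    by blast
  define \<omega> :: "real ^ 'v" where "\<omega> = (\<chi> i. w i)"
  have lt: "mon_wdeg \<omega> s < mon_wdeg \<omega> t" if "(s, t) \<in> C" for s t
    using w[OF that] by (simp add: mon_wdeg_def \<omega>_def diff_def algebra_simps sum_subtractf)
  have "0 \<le> \<omega> $ i" for i
  proof -
    have "mon_wdeg \<omega> 0 < mon_wdeg \<omega> (Poly_Mapping.single i 1)"
      by (rule lt) (auto simp: C_def)
    moreover have "mon_wdeg \<omega> (Poly_Mapping.single i 1) = \<omega> $ i"
      by (simp add: mon_wdeg_def lookup_single when_def if_distrib cong: if_cong)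
    ultimately show ?thesis by (simp add: mon_wdeg_def)
  qed
  then have "\<omega> \<in> weights" by (simp add: weights_def)
  moreover have "\<forall>(s, t)\<in>B. mon_wdeg \<omega> s < mon_wdeg \<omega> t"
    using lt by (auto simp: C_def)
  ultimately show ?thesis by blast
qed


section \<open>Groebner cones are cut out by the reduced Groebner basis\<close>

lemma monomial_order_weight_order:
  assumes mo: "monomial_order prec" and w: "\<omega> \<in> weights"
  shows "monomial_order (weight_order \<omega> prec)"
  unfolding monomial_order_def
proof (intro conjI allI impI)
  show "irreflp (weight_order \<omega> prec)"
    using mo_irrefl[OF mo] by (auto simp: irreflp_def weight_order_def)
  show "transp (weight_order \<omega> prec)"
    unfolding transp_def weight_order_def using mo_trans[OF mo] by (metis order_less_trans)
  show "totalp (weight_order \<omega> prec)"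
    unfolding totalp_on_def weight_order_def using mo_total[OF mo] by (metis linorder_neqE)
  show "weight_order \<omega> prec 0 s" if "s \<noteq> 0" for s
    using that mo mon_wdeg_nonneg[OF w, of s] unfolding weight_order_def monomial_order_def
    by (simp add: mon_wdeg_def less_le)
  show "weight_order \<omega> prec (s + u) (t + u)" if "weight_order \<omega> prec s t" for s t u
    using that mo_add[OF mo, of s t u] by (auto simp: weight_order_def mon_wdeg_add add.commute)
qed

lemma refines_weight_weight_order: "refines_weight (weight_order \<omega> prec) \<omega>"
  by (simp add: refines_weight_def weight_order_def)

lemma keys_wlt: "Poly_Mapping.keys (wlt \<omega> f) = {s \<in> Poly_Mapping.keys f. mon_wdeg \<omega> s = wdeg \<omega> f}"
proof -
  have "Poly_Mapping.lookup (wlt \<omega> f) t =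
      (if t \<in> Poly_Mapping.keys f \<and> mon_wdeg \<omega> t = wdeg \<omega> f then Poly_Mapping.lookup f t else 0)" for t
    by (auto simp: wlt_def lookup_sum lookup_single when_def)
  then show ?thesis by (auto simp: in_keys_iff split: if_splits)
qed

lemma mon_wdeg_le_wdeg: "s \<in> Poly_Mapping.keys f \<Longrightarrow> mon_wdeg \<omega> s \<le> wdeg \<omega> f"
  by (simp add: wdeg_def)

lemma wdeg_attained:
  assumes "f \<noteq> 0"
  obtains s where "s \<in> Poly_Mapping.keys f" "mon_wdeg \<omega> s = wdeg \<omega> f"
proof -
  have "wdeg \<omega> f \<in> mon_wdeg \<omega> ` Poly_Mapping.keys f"
    unfolding wdeg_def using assms by (intro Max_in) auto
  then show thesis using that by auto
qed

text \<open>
  The initial ideals for \<open>prec\<close> and for \<open>weight_order \<omega> prec\<close> coincide, since the elements of \<open>G\<close> have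
  the same leading monomials for both. It remains to see that the monomials of maximal weight \<open>d\<close> of
  an element \<open>f\<close> of \<open>I\<close> are leading monomials. The largest of them is the leading monomial of \<open>f\<close>
  for \<open>weight_order \<omega> prec\<close>; one division step by an element of \<open>G\<close> removes it and changes no
  other monomial of weight \<open>d\<close>, because the tails of \<open>G\<close> have strictly smaller weight.
\<close>

lemma winitial_ideal_eq:
  fixes I :: "('v::finite, 'a::field) mpoly set"
  assumes mo: "monomial_order prec" and I: "ideal.subspace I" and w: "\<omega> \<in> weights"
    and G: "is_reduced_GB prec I G"
    and strict: "\<And>g s. g \<in> G \<Longrightarrow> s \<in> Poly_Mapping.keys g \<Longrightarrow> s \<noteq> lead_mon prec g \<Longrightarrow>
      mon_wdeg \<omega> s < mon_wdeg \<omega> (lead_mon prec g)"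
  shows "winitial_ideal \<omega> I = initial_ideal prec I"
proof -
  define wo where "wo = weight_order \<omega> prec"
  define M where "M = leads prec I"
  note G' = G[unfolded is_reduced_GB_iff[OF mo]]
  have mow: "monomial_order wo"
    unfolding wo_def using mo w by (rule monomial_order_weight_order)
  have G0: "g \<in> I" "g \<noteq> 0" if "g \<in> G" for g using G' that by auto
  have lead_wo: "lead_mon wo g = lead_mon prec g" if "g \<in> G" for g
    using lead_mon(1)[OF mo G0(2)[OF that]] strict[OF that]
    by (intro lead_mon_eqI[OF mow]) (auto simp: wo_def weight_order_def)
  have divisor: "\<exists>g\<in>G. mon_dvd (lead_mon prec g) s" if "s \<in> M" for s
    using G' that unfolding M_def leads_def by blast
  have "M \<subseteq> leads wo I"
  proof
    fix s assume "s \<in> M"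
    then obtain g where g: "g \<in> G" "mon_dvd (lead_mon prec g) s" using divisor by blast
    then have "lead_mon wo g \<in> leads wo I" using G0 leadsI by blast
    then show "s \<in> leads wo I"
      using upsetD[OF upset_leads[OF mow I]] g lead_wo by metis
  qed
  then have leads_wo: "leads wo I = M"
    unfolding M_def using leads_subset_imp_eq[OF mo mow I] by simp
  have top: "\<forall>f. f \<in> I \<longrightarrow> f \<noteq> 0 \<longrightarrow> lead_mon wo f = m \<longrightarrow> (\<forall>t\<in>Poly_Mapping.keys f. mon_wdeg \<omega> t \<le> d) \<longrightarrow>
      (\<forall>s\<in>Poly_Mapping.keys f. mon_wdeg \<omega> s = d \<longrightarrow> s \<in> M)" for m d
  proof (induction m rule: wfp_induct_rule[OF wfp_monomial_order[OF mow]])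
    case (1 m)
    show ?case
    proof (intro allI impI ballI)
      fix f s assume f: "f \<in> I" "f \<noteq> 0" "lead_mon wo f = m"
        and deg_f: "\<forall>t\<in>Poly_Mapping.keys f. mon_wdeg \<omega> t \<le> d"
        and s: "s \<in> Poly_Mapping.keys f" "mon_wdeg \<omega> s = d"
      have m: "m \<in> M" using leadsI[OF f(1,2), of wo] leads_wo f(3) by simp
      have f_below: "wo t m" if "t \<in> Poly_Mapping.keys f" "t \<noteq> m" for t
        using lead_mon(2)[OF mow f(2) that(1)] that(2) f(3) by simp
      show "s \<in> M"
      proof (cases "s = m")
        case False
        have deg_m: "mon_wdeg \<omega> m = d"
          using f_below[OF s(1) False] s(2) deg_f lead_mon(1)[OF mow f(2)] f(3)
          by (auto simp: wo_def weight_order_def intro: antisym)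
        obtain g where g: "g \<in> G" "mon_dvd (lead_mon prec g) m" using divisor[OF m] by blast
        then obtain u where u: "m = u + lead_mon prec g" by (auto simp: mon_dvd_def add.commute)
        define h where "h = Poly_Mapping.single u (Poly_Mapping.lookup f m) * g"
        have f_m: "Poly_Mapping.lookup f m \<noteq> 0"
          using lead_coeff_nonzero[OF mow f(2)] f(3) by simp
        have keys_h: "Poly_Mapping.keys h = (+) u ` Poly_Mapping.keys g"
          unfolding h_def by (rule keys_single_mult[OF f_m])
        have h_m: "Poly_Mapping.lookup h m = Poly_Mapping.lookup f m"
          using G' g(1) single_mult_lookup(1)[of u "Poly_Mapping.lookup f m" g "lead_mon prec g"]
          by (simp add: h_def u)
        have deg_h: "mon_wdeg \<omega> t < d" if "t \<in> Poly_Mapping.keys h" "t \<noteq> m" for t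
        proof -
          obtain b where "b \<in> Poly_Mapping.keys g" "t = u + b" using \<open>t \<in> Poly_Mapping.keys h\<close> keys_h by auto
          then show ?thesis
            using strict[OF g(1), of b] \<open>t \<noteq> m\<close> deg_m by (auto simp: u mon_wdeg_add)
        qed
        have key_cases: "t \<noteq> m \<and> (t \<in> Poly_Mapping.keys f \<or> t \<in> Poly_Mapping.keys h)"
          if "t \<in> Poly_Mapping.keys (f - h)" for t
          using that h_m by (auto simp: in_keys_iff lookup_minus)
        have s_fh: "s \<in> Poly_Mapping.keys (f - h)"
          using s deg_h[of s] False by (auto simp: in_keys_iff lookup_minus)
        then have fh0: "f - h \<noteq> 0" by force
        have "f - h \<in> I"
          unfolding h_def using f(1) G0(1)[OF g(1)]
          by (intro ideal.subspace_diff[OF I] ideal.subspace_scale[OF I])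
        moreover have "wo (lead_mon wo (f - h)) m"
          using key_cases[OF lead_mon(1)[OF mow fh0]] f_below deg_h deg_m
          by (auto simp: wo_def weight_order_def)
        moreover have "\<forall>t\<in>Poly_Mapping.keys (f - h). mon_wdeg \<omega> t \<le> d"
          using key_cases deg_f deg_h by (meson less_imp_le)
        ultimately show ?thesis
          using "1.IH" fh0 s_fh s(2) by blast
      qed (use m in simp)
    qed
  qed
  show ?thesis
    unfolding winitial_ideal_def initial_ideal_eq[OF mo I]
  proof (rule ideal_gen_eq_monomial_ideal[OF upset_leads[OF mo I]])
    fix p assume "p \<in> wlt \<omega> ` (I - {0})"
    then obtain f where f: "f \<in> I" "f \<noteq> 0" "p = wlt \<omega> f" by blast
    have "\<forall>t\<in>Poly_Mapping.keys f. mon_wdeg \<omega> t \<le> wdeg \<omega> f"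
      using mon_wdeg_le_wdeg by blast
    with top f(1,2) show "Poly_Mapping.keys p \<subseteq> leads prec I"
      unfolding f(3) keys_wlt M_def by blast
  next
    fix s assume "s \<in> leads prec I"
    then obtain g where g: "g \<in> G" "mon_dvd (lead_mon prec g) s"
      using divisor unfolding M_def by blast
    let ?a = "lead_mon prec g"
    obtain t where t: "t \<in> Poly_Mapping.keys g" "mon_wdeg \<omega> t = wdeg \<omega> g"
      by (rule wdeg_attained[OF G0(2)[OF g(1)]])
    have a: "?a \<in> Poly_Mapping.keys g" by (rule lead_mon(1)[OF mo G0(2)[OF g(1)]])
    have "t = ?a"
      using strict[OF g(1) t(1)] t(2) mon_wdeg_le_wdeg[OF a, of \<omega>] by force
    then have "{s \<in> Poly_Mapping.keys g. mon_wdeg \<omega> s = wdeg \<omega> g} = {?a}"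
      using t strict[OF g(1)] by force
    then have "wlt \<omega> g = Poly_Mapping.single ?a (Poly_Mapping.lookup g ?a)"
      by (simp add: wlt_def)
    then have "Poly_Mapping.single ?a (Poly_Mapping.lookup g ?a) \<in> wlt \<omega> ` (I - {0})"
      using G0[OF g(1)] by (metis DiffI image_eqI singletonD)
    then show "\<exists>a c. c \<noteq> 0 \<and> Poly_Mapping.single a c \<in> wlt \<omega> ` (I - {0}) \<and> mon_dvd a s"
      using g(2) lead_coeff_nonzero[OF mo G0(2)[OF g(1)]] by blast
  qed
qed

text \<open>
  Conversely, \<open>wlt \<omega> g\<close> is supported on the initial ideal, in which the leading monomial is the only
  monomial of \<open>g\<close>; hence it is the only monomial of \<open>g\<close> of maximal weight.
\<close>

lemma winitial_ideal_eq_imp_strict: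
  fixes I :: "('v::finite, 'a::field) mpoly set"
  assumes mo: "monomial_order prec" and I: "ideal.subspace I"
    and G: "is_reduced_GB prec I G" and eq: "winitial_ideal \<omega> I = initial_ideal prec I"
    and g: "g \<in> G" and s: "s \<in> Poly_Mapping.keys g" "s \<noteq> lead_mon prec g"
  shows "mon_wdeg \<omega> s < mon_wdeg \<omega> (lead_mon prec g)"
proof -
  have g0: "g \<in> I" "g \<noteq> 0"
    using G[unfolded is_reduced_GB_iff[OF mo]] g by auto
  then have "wlt \<omega> g \<in> winitial_ideal \<omega> I"
    unfolding winitial_ideal_def by (intro ideal.span_base) auto
  then have "Poly_Mapping.keys (wlt \<omega> g) \<subseteq> leads prec I"
    unfolding eq initial_ideal_eq[OF mo I] monomial_ideal_def by blast
  then have top: "t = lead_mon prec g" if "t \<in> Poly_Mapping.keys g" "mon_wdeg \<omega> t = wdeg \<omega> g" for t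
    using reduced_GB_key_in_leads[OF mo G g] that by (auto simp: keys_wlt)
  obtain t where "t \<in> Poly_Mapping.keys g" "mon_wdeg \<omega> t = wdeg \<omega> g"
    by (rule wdeg_attained[OF g0(2)])
  then have "mon_wdeg \<omega> (lead_mon prec g) = wdeg \<omega> g" using top by blast
  moreover have "mon_wdeg \<omega> s \<noteq> wdeg \<omega> g" using top s by blast
  ultimately show ?thesis using mon_wdeg_le_wdeg[OF s(1), of \<omega>] by simp
qed

text \<open>
  The weights that represent the initial ideal are cut out by the strict versions of these inequalities.
  They form a nonempty set by \<open>ex_weight_for_comparisons\<close>, and adding a small multiple of a point of it
  to a solution of the weak inequalities makes them strict, so the closure is described by the weak ones.
\<close>

lemma gcone_eq:
  fixes I :: "('v::finite, 'a::field) mpoly set"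
  assumes mo: "monomial_order prec" and I: "ideal.subspace I" and G: "is_reduced_GB prec I G"
  shows "gcone I prec = {\<omega> \<in> weights. \<forall>g\<in>G. \<forall>s\<in>Poly_Mapping.keys g.
    mon_wdeg \<omega> s \<le> mon_wdeg \<omega> (lead_mon prec g)}" (is "_ = ?C")
proof
  note G' = G[unfolded is_reduced_GB_iff[OF mo]]
  define T where "T = {\<omega> \<in> weights. \<forall>g\<in>G. \<forall>s\<in>Poly_Mapping.keys g.
    s \<noteq> lead_mon prec g \<longrightarrow> mon_wdeg \<omega> s < mon_wdeg \<omega> (lead_mon prec g)}"
  have "{\<omega> \<in> weights. winitial_ideal \<omega> I = initial_ideal prec I} = T"
    unfolding T_def using winitial_ideal_eq[OF mo I _ G] winitial_ideal_eq_imp_strict[OF mo I G] by blast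
  then have gcone: "gcone I prec = closure T" by (simp add: gcone_def)
  have closed: "closed ?C"
  proof -
    have "?C = (\<Inter>i. {\<omega>. 0 \<le> \<omega> $ i}) \<inter>
        (\<Inter>g\<in>G. \<Inter>s\<in>Poly_Mapping.keys g. {\<omega>. mon_wdeg \<omega> s \<le> mon_wdeg \<omega> (lead_mon prec g)})"
      by (auto simp: weights_def)
    also have "closed \<dots>"
      by (intro closed_Int closed_INT ballI closed_Collect_le continuous_intros)
    finally show ?thesis .
  qed
  have "T \<subseteq> ?C" unfolding T_def by force
  then show "gcone I prec \<subseteq> ?C"
    unfolding gcone using closed by (rule closure_minimal)
  define B where "B = (\<Union>g\<in>G. (\<lambda>s. (s, lead_mon prec g)) ` (Poly_Mapping.keys g - {lead_mon prec g}))"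
  have "finite B" using G' by (simp add: B_def)
  moreover have "prec s t" if st: "(s, t) \<in> B" for s t
  proof -
    obtain g where "g \<in> G" "s \<in> Poly_Mapping.keys g" "s \<noteq> lead_mon prec g" "t = lead_mon prec g"
      using st by (auto simp: B_def)
    then show ?thesis using lead_mon(2)[OF mo, of g s] G' by auto
  qed
  ultimately obtain \<omega>\<^sub>0 where w0: "\<omega>\<^sub>0 \<in> weights" "\<forall>(s, t)\<in>B. mon_wdeg \<omega>\<^sub>0 s < mon_wdeg \<omega>\<^sub>0 t"
    using ex_weight_for_comparisons[OF mo] by blast
  show "?C \<subseteq> gcone I prec"
    unfolding gcone
  proof
    fix \<omega> assume \<omega>: "\<omega> \<in> ?C"
    have "\<omega> + (1 / real (Suc n)) *\<^sub>R \<omega>\<^sub>0 \<in> T" for n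
    proof -
      define e where "e = 1 / real (Suc n)"
      have e: "0 < e" by (simp add: e_def)
      have "\<omega> + e *\<^sub>R \<omega>\<^sub>0 \<in> weights"
        using \<omega> w0(1) e by (simp add: weights_def)
      moreover have "mon_wdeg (\<omega> + e *\<^sub>R \<omega>\<^sub>0) s < mon_wdeg (\<omega> + e *\<^sub>R \<omega>\<^sub>0) (lead_mon prec g)"
        if "g \<in> G" "s \<in> Poly_Mapping.keys g" "s \<noteq> lead_mon prec g" for g s
      proof -
        have "mon_wdeg \<omega> s \<le> mon_wdeg \<omega> (lead_mon prec g)" using \<omega> that by blast
        moreover have "(s, lead_mon prec g) \<in> B" using that by (auto simp: B_def)
        then have "mon_wdeg \<omega>\<^sub>0 s < mon_wdeg \<omega>\<^sub>0 (lead_mon prec g)" using w0(2) by auto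
        then have "e * mon_wdeg \<omega>\<^sub>0 s < e * mon_wdeg \<omega>\<^sub>0 (lead_mon prec g)" using e by simp
        ultimately show ?thesis
          unfolding mon_wdeg_weight_add mon_wdeg_weight_scale by linarith
      qed
      ultimately show ?thesis
        unfolding T_def e_def by blast
    qed
    moreover have "(\<lambda>n. \<omega> + (1 / real (Suc n)) *\<^sub>R \<omega>\<^sub>0) \<longlonglongrightarrow> \<omega> + 0 *\<^sub>R \<omega>\<^sub>0"
      using LIMSEQ_inverse_real_of_nat by (intro tendsto_intros) (simp add: inverse_eq_divide)
    ultimately show "\<omega> \<in> closure T"
      unfolding closure_sequential
      by (intro exI[of _ "\<lambda>n. \<omega> + (1 / real (Suc n)) *\<^sub>R \<omega>\<^sub>0"]) simp
  qed
qed

lemma finite_gcones: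
  fixes I :: "('v::finite, 'a::field) mpoly set"
  assumes I: "ideal.subspace I"
  shows "finite {gcone I prec |prec. monomial_order prec}"
proof -
  define cone where "cone L = closure {\<omega> \<in> weights. winitial_ideal \<omega> I = monomial_ideal L}" for L
  have "{gcone I prec |prec. monomial_order prec} \<subseteq> cone ` {leads prec I |prec. monomial_order prec}"
  proof
    fix C assume "C \<in> {gcone I prec |prec. monomial_order prec}"
    then obtain prec where prec: "monomial_order prec" "C = gcone I prec" by blast
    then have "C = cone (leads prec I)"
      by (simp add: gcone_def cone_def initial_ideal_eq[OF prec(1) I])
    with prec(1) show "C \<in> cone ` {leads prec I |prec. monomial_order prec}" by blast
  qed
  then show ?thesis
    using finite_leads[OF I] by (rule finite_surj[rotated])
qed


section \<open>Moving along a segment through Groebner cones\<close>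

text \<open>
  The intersection is a compact convex subset of a segment, hence a segment, and the endpoint \<open>a\<close> is one
  of its extreme points.
\<close>

lemma ex1_closed_segment_Int:
  fixes a b :: "'a::euclidean_space"
  assumes "closed C" "convex C" "a \<in> C"
  shows "\<exists>!c. closed_segment a c = closed_segment a b \<inter> C"
proof -
  define S where "S = closed_segment a b \<inter> C"
  have a: "a \<in> S" using assms(3) by (simp add: S_def)
  have "compact S" "convex S"
    using assms by (auto simp: S_def intro: compact_Int_closed convex_Int)
  moreover have "collinear S"
    unfolding S_def by (rule collinear_subset[OF collinear_closed_segment]) auto
  ultimately obtain c d where cd: "S = closed_segment c d"
    using compact_convex_collinear_segment[of S] a by blast
  have "a extreme_point_of closed_segment a b"
    by (simp add: extreme_point_of_segment)
  then have "a extreme_point_of S"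
    using a unfolding extreme_point_of_def S_def by blast
  then have "a = c \<or> a = d"
    by (simp add: cd extreme_point_of_segment)
  then have ex: "\<exists>c. closed_segment a c = S"
    using cd by (auto simp: closed_segment_commute)
  show ?thesis
    unfolding S_def[symmetric] using ex by (auto simp: closed_segment_eq doubleton_eq_iff)
qed

lemma convex_weights: "convex weights"
  unfolding convex_alt weights_def by auto

lemma convex_gcone:
  fixes I :: "('v::finite, 'a::field) mpoly set"
  assumes mo: "monomial_order prec" and I: "ideal.subspace I"
  shows "convex (gcone I prec)"
proof -
  have "convex {\<omega>. mon_wdeg \<omega> s \<le> mon_wdeg \<omega> t}" for s t :: "'v monomial"
    unfolding convex_alt
    by (auto simp: mon_wdeg_weight_add mon_wdeg_weight_scale intro!: add_mono mult_left_mono)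
  then have "convex (weights \<inter> (\<Inter>g\<in>GB I prec. \<Inter>s\<in>Poly_Mapping.keys g.
      {\<omega>. mon_wdeg \<omega> s \<le> mon_wdeg \<omega> (lead_mon prec g)}))"
    by (intro convex_Int convex_INT convex_weights)
  also have "\<dots> = gcone I prec"
    unfolding gcone_eq[OF mo I is_reduced_GB_GB[OF mo I]] by auto
  finally show ?thesis .
qed

lemma refined_weight_in_gcone:
  fixes I :: "('v::finite, 'a::field) mpoly set"
  assumes mo: "monomial_order prec" and I: "ideal.subspace I"
    and w: "\<omega> \<in> weights" and ref: "refines_weight prec \<omega>"
  shows "\<omega> \<in> gcone I prec"
proof -
  have "mon_wdeg \<omega> s \<le> mon_wdeg \<omega> (lead_mon prec g)"
    if "g \<in> GB I prec" "s \<in> Poly_Mapping.keys g" for g s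
  proof (cases "s = lead_mon prec g")
    case False
    have "g \<noteq> 0" using that(2) by auto
    then have "prec s (lead_mon prec g)"
      using lead_mon(2)[OF mo] that(2) False by blast
    then have "\<not> prec (lead_mon prec g) s" by (rule mo_asym[OF mo])
    then show ?thesis
      using ref unfolding refines_weight_def by (meson not_less)
  qed simp
  then show ?thesis
    unfolding gcone_eq[OF mo I is_reduced_GB_GB[OF mo I]] using w by blast
qed

text \<open>
  The cone of \<open>weight_order \<omega> prec\<close> contains points of the segment beyond \<open>\<omega>\<close>. An inequality of the
  cone that is strict at \<open>\<omega>\<close> remains valid nearby; where equality holds at \<open>\<omega>\<close>, the comparison was
  decided by \<open>prec\<close>, which refines \<open>\<tau>\<close>, so the inequality holds at \<open>\<tau>\<close> and hence on the
  whole segment.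
\<close>

lemma gcone_reaches_towards:
  fixes I :: "('v::finite, 'a::field) mpoly set"
  assumes mo: "monomial_order prec" and I: "ideal.subspace I"
    and w: "\<omega> \<in> weights" "\<tau> \<in> weights" "\<omega> \<noteq> \<tau>" and ref: "refines_weight prec \<tau>"
  shows "\<exists>x\<in>closed_segment \<omega> \<tau> \<inter> gcone I (weight_order \<omega> prec). x \<noteq> \<omega>"
proof -
  define wo where "wo = weight_order \<omega> prec"
  have mow: "monomial_order wo"
    unfolding wo_def using mo w(1) by (rule monomial_order_weight_order)
  define G where "G = GB I wo"
  have G: "is_reduced_GB wo I G"
    unfolding G_def using mow I by (rule is_reduced_GB_GB)
  define p where "p e = (1 - e) *\<^sub>R \<omega> + e *\<^sub>R \<tau>" for e :: real
  have deg_p: "mon_wdeg (p e) s = (1 - e) * mon_wdeg \<omega> s + e * mon_wdeg \<tau> s" for e s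
    by (simp add: p_def mon_wdeg_weight_add mon_wdeg_weight_scale)
  have "\<forall>\<^sub>F e in at_right 0. mon_wdeg (p e) s \<le> mon_wdeg (p e) (lead_mon wo g)"
    if gs: "g \<in> G" "s \<in> Poly_Mapping.keys g" for g s
  proof (cases "s = lead_mon wo g")
    case False
    have "g \<noteq> 0" using gs(2) by auto
    then have "wo s (lead_mon wo g)"
      using lead_mon(2)[OF mow] gs(2) False by blast
    then consider "mon_wdeg \<omega> s < mon_wdeg \<omega> (lead_mon wo g)"
      | "mon_wdeg \<omega> s = mon_wdeg \<omega> (lead_mon wo g)" "prec s (lead_mon wo g)"
      by (auto simp: wo_def weight_order_def)
    then show ?thesis
    proof cases
      case 1
      have "((\<lambda>e. mon_wdeg (p e) (lead_mon wo g) - mon_wdeg (p e) s) \<longlongrightarrow>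
          ((1 - 0) * mon_wdeg \<omega> (lead_mon wo g) + 0 * mon_wdeg \<tau> (lead_mon wo g)) -
          ((1 - 0) * mon_wdeg \<omega> s + 0 * mon_wdeg \<tau> s)) (at_right 0)"
        unfolding deg_p by (intro tendsto_intros)
      from order_tendstoD(1)[OF this, of 0] 1
      have "\<forall>\<^sub>F e in at_right 0. 0 < mon_wdeg (p e) (lead_mon wo g) - mon_wdeg (p e) s"
        by simp
      then show ?thesis by eventually_elim simp
    next
      case 2
      have "mon_wdeg \<tau> s \<le> mon_wdeg \<tau> (lead_mon wo g)"
        using ref mo_asym[OF mo 2(2)] unfolding refines_weight_def by (meson not_less)
      then have "mon_wdeg (p e) s \<le> mon_wdeg (p e) (lead_mon wo g)" if "0 < e" for e
        using 2(1) that by (simp add: deg_p mult_left_mono)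
      then show ?thesis
        using eventually_at_right_less[of "0::real"] by (rule eventually_mono[rotated])
    qed
  qed simp
  moreover have "finite G"
    using G by (simp add: is_reduced_GB_iff[OF mow])
  ultimately have "\<forall>\<^sub>F e in at_right 0. \<forall>g\<in>G. \<forall>s\<in>Poly_Mapping.keys g.
      mon_wdeg (p e) s \<le> mon_wdeg (p e) (lead_mon wo g)"
    by (intro eventually_ball_finite ballI) auto
  moreover have "\<forall>\<^sub>F e in at_right 0. 0 < e \<and> e < (1::real)"
    by (auto simp: eventually_at_right_field intro: exI[of _ 1])
  ultimately have "\<forall>\<^sub>F e in at_right 0. (\<forall>g\<in>G. \<forall>s\<in>Poly_Mapping.keys g.
      mon_wdeg (p e) s \<le> mon_wdeg (p e) (lead_mon wo g)) \<and> 0 < e \<and> e < 1"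
    by (rule eventually_conj)
  from eventually_happens'[OF trivial_limit_at_right_real this]
  obtain e where e: "\<forall>g\<in>G. \<forall>s\<in>Poly_Mapping.keys g.
      mon_wdeg (p e) s \<le> mon_wdeg (p e) (lead_mon wo g)" "0 < e" "e < 1"
    by blast
  have seg: "p e \<in> closed_segment \<omega> \<tau>"
    unfolding p_def closed_segment_def using e(2,3) by auto
  moreover have "p e \<in> weights"
    using seg convex_contains_segment[of weights] convex_weights w by blast
  then have "p e \<in> gcone I wo"
    unfolding gcone_eq[OF mow I G] using e(1) by blast
  moreover have "p e \<noteq> \<omega>"
  proof
    assume "p e = \<omega>"
    then have "e *\<^sub>R (\<tau> - \<omega>) = 0" by (simp add: p_def algebra_simps)
    then show False using e(2) w(3) by simp
  qed
  ultimately show ?thesis unfolding wo_def by blast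
qed


section \<open>The subring without the eliminated variables\<close>

lemma lookup_incl_mon [simp]:
  "Poly_Mapping.lookup (incl_mon s :: ('n + 'm) monomial) (Inl i) = Poly_Mapping.lookup s i"
  "Poly_Mapping.lookup (incl_mon s :: ('n + 'm) monomial) (Inr j) = 0"
  by (auto simp: incl_mon_def lookup_sum lookup_single when_def in_keys_iff)

lemma incl_mon_eq_iff [simp]: "incl_mon s = incl_mon t \<longleftrightarrow> s = t"
  by (metis lookup_incl_mon(1) poly_mapping_eqI)

lemma incl_mon_add: "incl_mon (s + t) = incl_mon s + (incl_mon t :: ('n + 'm) monomial)"
proof (rule poly_mapping_eqI)
  fix k :: "'n + 'm"
  show "Poly_Mapping.lookup (incl_mon (s + t)) k = Poly_Mapping.lookup (incl_mon s + incl_mon t) k"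
    by (cases k) (simp_all add: lookup_add)
qed

lemma incl_mon_0 [simp]: "incl_mon 0 = 0"
  by (simp add: incl_mon_def)

lemma mon_dvd_incl_mon_iff:
  "mon_dvd (incl_mon s :: ('n + 'm) monomial) (incl_mon t) \<longleftrightarrow> mon_dvd s t"
  unfolding mon_dvd_iff_lookup_le
proof (intro iffI allI)
  fix k :: "'n + 'm"
  assume "\<forall>i. Poly_Mapping.lookup s i \<le> Poly_Mapping.lookup t i"
  then show "Poly_Mapping.lookup (incl_mon s) k \<le> Poly_Mapping.lookup (incl_mon t) k"
    by (cases k) simp_all
qed (metis lookup_incl_mon(1))

lemma range_incl_mon:
  fixes s :: "('n::finite + 'm) monomial"
  shows "s \<in> range incl_mon \<longleftrightarrow> (\<forall>j. Poly_Mapping.lookup s (Inr j) = 0)"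
proof
  assume s: "\<forall>j. Poly_Mapping.lookup s (Inr j) = 0"
  define p where "p = Abs_poly_mapping (\<lambda>i. Poly_Mapping.lookup s (Inl i))"
  have p: "Poly_Mapping.lookup p i = Poly_Mapping.lookup s (Inl i)" for i
    by (simp add: p_def lookup_Abs_poly_mapping)
  have "s = incl_mon p"
  proof (rule poly_mapping_eqI)
    fix k :: "'n + 'm"
    show "Poly_Mapping.lookup s k = Poly_Mapping.lookup (incl_mon p) k"
      using s by (cases k) (simp_all add: p)
  qed
  then show "s \<in> range incl_mon" by blast
qed auto

lemma lookup_incl:
  fixes f :: "('n, 'a::comm_monoid_add) mpoly"
  shows "Poly_Mapping.lookup (incl f) (incl_mon s :: ('n + 'm) monomial) = Poly_Mapping.lookup f s"
    and "t \<notin> range incl_mon \<Longrightarrow> Poly_Mapping.lookup (incl f :: ('n + 'm, 'a::comm_monoid_add) mpoly) t = 0"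
proof -
  have eq: "Poly_Mapping.lookup (incl f :: ('n + 'm, 'a::comm_monoid_add) mpoly) t =
      (\<Sum>s\<in>Poly_Mapping.keys f. Poly_Mapping.lookup f s when incl_mon s = t)" for t f
    by (simp add: incl_def lookup_sum lookup_single)
  show "Poly_Mapping.lookup (incl f) (incl_mon s :: ('n + 'm) monomial) = Poly_Mapping.lookup f s"
    by (simp add: eq when_def in_keys_iff)
  show "Poly_Mapping.lookup (incl f :: ('n + 'm, 'a::comm_monoid_add) mpoly) t = 0"
    if "t \<notin> range incl_mon"
    unfolding eq using that by (intro sum.neutral) (auto simp: when_def)
qed

lemma keys_incl:
  "Poly_Mapping.keys (incl f :: ('n + 'm, 'a::comm_monoid_add) mpoly) = incl_mon ` Poly_Mapping.keys f"
proof (intro set_eqI)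
  fix t :: "('n + 'm) monomial"
  show "t \<in> Poly_Mapping.keys (incl f) \<longleftrightarrow> t \<in> incl_mon ` Poly_Mapping.keys f"
    by (cases "t \<in> range incl_mon") (auto simp: in_keys_iff lookup_incl)
qed

lemma inj_incl: "inj (incl :: ('n, 'a::comm_monoid_add) mpoly \<Rightarrow> ('n + 'm, 'a) mpoly)"
proof (rule injI)
  fix f g :: "('n, 'a) mpoly"
  assume "(incl f :: ('n + 'm, 'a) mpoly) = incl g"
  then show "f = g"
    by (metis lookup_incl(1) poly_mapping_eqI)
qed

lemma incl_0 [simp]: "incl 0 = 0"
  by (simp add: incl_def)

lemma KX_iff:
  fixes f :: "('n::finite + 'm, 'a::comm_monoid_add) mpoly"
  shows "f \<in> KX \<longleftrightarrow> (\<forall>s\<in>Poly_Mapping.keys f. \<forall>j. Poly_Mapping.lookup s (Inr j) = 0)"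
proof
  assume "f \<in> KX"
  then show "\<forall>s\<in>Poly_Mapping.keys f. \<forall>j. Poly_Mapping.lookup s (Inr j) = 0"
    by (auto simp: KX_def keys_incl)
next
  assume "\<forall>s\<in>Poly_Mapping.keys f. \<forall>j. Poly_Mapping.lookup s (Inr j) = 0"
  then have keys: "s \<in> range incl_mon" if "Poly_Mapping.lookup f s \<noteq> 0" for s
    using that by (simp add: range_incl_mon in_keys_iff)
  define h where "h = Abs_poly_mapping (\<lambda>p. Poly_Mapping.lookup f (incl_mon p))"
  have "finite (incl_mon -` Poly_Mapping.keys f :: 'n monomial set)"
    by (intro finite_vimageI) (auto simp: inj_def)
  then have "finite {p :: 'n monomial. Poly_Mapping.lookup f (incl_mon p) \<noteq> 0}"
    by (simp add: vimage_def in_keys_iff)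
  then have h: "Poly_Mapping.lookup h p = Poly_Mapping.lookup f (incl_mon p)" for p
    by (simp add: h_def lookup_Abs_poly_mapping)
  have "f = incl h"
  proof (rule poly_mapping_eqI)
    fix t
    show "Poly_Mapping.lookup f t = Poly_Mapping.lookup (incl h) t"
      using keys[of t] by (cases "t \<in> range incl_mon") (auto simp: lookup_incl h)
  qed
  then show "f \<in> KX" by (simp add: KX_def)
qed

lemma monomial_order_restrict_order:
  assumes mo: "monomial_order (prec :: ('n::finite + 'm::finite) mrel)"
  shows "monomial_order (restrict_order prec)"
  unfolding monomial_order_def
proof (intro conjI allI impI)
  show "irreflp (restrict_order prec)"
    using mo_irrefl[OF mo] by (auto simp: irreflp_def restrict_order_def)
  show "transp (restrict_order prec)"
    unfolding transp_def restrict_order_def using mo_trans[OF mo] by blast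
  show "totalp (restrict_order prec)"
    unfolding totalp_on_def restrict_order_def using mo_total[OF mo] by simp
  fix s t u :: "'n monomial"
  show "restrict_order prec 0 s" if "s \<noteq> 0"
    using mo that incl_mon_eq_iff[of s 0] unfolding monomial_order_def restrict_order_def
    by (metis incl_mon_0 incl_mon_eq_iff)
  show "restrict_order prec (s + u) (t + u)" if "restrict_order prec s t"
    using that mo unfolding monomial_order_def restrict_order_def by (simp add: incl_mon_add)
qed

lemma lead_mon_incl:
  fixes f :: "('n::finite, 'a::comm_monoid_add) mpoly"
  assumes mo: "monomial_order (prec :: ('n + 'm::finite) mrel)" and "f \<noteq> 0"
  shows "lead_mon prec (incl f) = incl_mon (lead_mon (restrict_order prec) f)"
proof (rule lead_mon_eqI[OF mo])
  note lead = lead_mon[OF monomial_order_restrict_order[OF mo] \<open>f \<noteq> 0\<close>]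
  show "incl_mon (lead_mon (restrict_order prec) f) \<in> Poly_Mapping.keys (incl f)"
    using lead(1) by (simp add: keys_incl)
  show "prec t (incl_mon (lead_mon (restrict_order prec) f))"
    if "t \<in> Poly_Mapping.keys (incl f)" "t \<noteq> incl_mon (lead_mon (restrict_order prec) f)" for t
    using that lead(2) by (auto simp: keys_incl restrict_order_def)
qed

lemma lt_in_KX_iff:
  fixes g :: "('n::finite + 'm::finite, 'a::field) mpoly"
  assumes mo: "monomial_order prec" and "g \<noteq> 0"
  shows "lt prec g \<in> KX \<longleftrightarrow> lead_mon prec g \<in> range incl_mon"
  using lead_coeff_nonzero[OF assms] by (simp add: KX_iff lt_def range_incl_mon)

text \<open>
  If the leading monomial of some \<open>g\<close> divides the leading monomial of an element of \<open>K[X]\<close>, then it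
  only involves x-variables, so \<open>g\<close> itself lies in \<open>K[X]\<close> by the elimination property. Therefore
  the elements of \<open>G\<close> in \<open>K[X]\<close> suffice; reducedness and leading coefficients are inherited along
  the inclusion.
\<close>

lemma is_reduced_GB_elimination_ideal:
  fixes I :: "('n::finite + 'm::finite, 'a::field) mpoly set"
  assumes mo: "monomial_order prec" and G: "is_reduced_GB prec I G"
    and elim: "\<forall>g\<in>G. lt prec g \<in> KX \<longrightarrow> g \<in> KX"
  shows "is_reduced_GB (restrict_order prec) (incl -` I) (incl -` (G \<inter> KX))"
proof -
  note mor = monomial_order_restrict_order[OF mo]
  note G' = G[unfolded is_reduced_GB_iff[OF mo]]
  have incl0: "(incl f :: ('n + 'm, 'a) mpoly) \<noteq> 0" if "f \<noteq> 0" for f :: "('n, 'a) mpoly"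
    using injD[OF inj_incl, of f 0] that by auto
  have R: "incl -` (G \<inter> KX) = incl -` G" by (auto simp: KX_def)
  have R0: "f \<noteq> 0" if "incl f \<in> G" for f using that G' by auto
  show ?thesis
    unfolding is_reduced_GB_iff[OF mor] R
  proof (intro conjI ballI impI)
    show "incl -` G \<subseteq> incl -` I" "0 \<notin> incl -` G" using G' by auto
    show "finite (incl -` G)" using G' inj_incl by (intro finite_vimageI) auto
  next
    fix f assume "f \<in> incl -` I - {0}"
    then have f: "incl f \<in> I - {0}" "f \<noteq> 0" using incl0 by auto
    then obtain g where g: "g \<in> G" "mon_dvd (lead_mon prec g) (lead_mon prec (incl f))"
      using G' by blast
    then have "Poly_Mapping.lookup (lead_mon prec g) (Inr j) = 0" for j
      using lookup_incl_mon(2)[of "lead_mon (restrict_order prec) f" j]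
      by (metis lead_mon_incl[OF mo f(2)] mon_dvd_iff_lookup_le le_zero_eq)
    moreover have "g \<noteq> 0" using g(1) G' by auto
    ultimately have "lt prec g \<in> KX"
      by (simp add: lt_in_KX_iff[OF mo] range_incl_mon)
    then have "g \<in> KX" using elim g(1) by blast
    then obtain h where h: "g = incl h" by (auto simp: KX_def)
    then have "h \<noteq> 0" using g(1) R0 by blast
    then have "mon_dvd (lead_mon (restrict_order prec) h) (lead_mon (restrict_order prec) f)"
      using g(2) by (simp add: h lead_mon_incl[OF mo] f(2) mon_dvd_incl_mon_iff)
    then show "\<exists>g\<in>incl -` G. mon_dvd (lead_mon (restrict_order prec) g) (lead_mon (restrict_order prec) f)"
      using g(1) h by blast
  next
    fix g h s assume gh: "g \<in> incl -` G" "h \<in> incl -` G" "g \<noteq> h" and s: "s \<in> Poly_Mapping.keys h"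
    have "incl g \<noteq> (incl h :: ('n + 'm, 'a) mpoly)"
      using injD[OF inj_incl] gh(3) by blast
    moreover have "incl_mon s \<in> Poly_Mapping.keys (incl h :: ('n + 'm, 'a) mpoly)"
      using s by (simp add: keys_incl)
    ultimately have "\<not> mon_dvd (lead_mon prec (incl g)) (incl_mon s)"
      using G' gh(1,2) by blast
    then show "\<not> mon_dvd (lead_mon (restrict_order prec) g) s"
      using R0 gh(1) by (simp add: lead_mon_incl[OF mo] mon_dvd_incl_mon_iff)
  next
    fix g assume g: "g \<in> incl -` G"
    then have "Poly_Mapping.lookup (incl g) (lead_mon prec (incl g)) = 1"
      using G' by blast
    then show "Poly_Mapping.lookup g (lead_mon (restrict_order prec) g) = 1"
      using R0 g by (simp add: lead_mon_incl[OF mo] lookup_incl)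
  qed
qed

text \<open>
  A monomial has \<open>\<tau>\<close>-weight 0 if and only if it only involves x-variables, and the leading
  monomial for \<open>prec\<close> has the largest \<open>\<tau>\<close>-weight.
\<close>

lemma specific_elim_order_of_weight:
  fixes I :: "('n::finite + 'm::finite, 'a::field) mpoly set"
  assumes mo: "monomial_order prec" and I: "ideal.subspace I" and ref: "refines_weight prec \<tau>"
    and \<tau>: "\<forall>i. \<tau> $ Inl i = 0" "\<forall>j. \<tau> $ Inr j > 0"
  shows "specific_elim_order I prec"
  unfolding specific_elim_order_def
proof (intro ballI impI)
  fix g assume g: "g \<in> GB I prec" "lt prec g \<in> KX"
  have "\<tau> $ k \<ge> 0" for k
    using \<tau> by (cases k) (auto intro: less_imp_le)
  then have deg0: "mon_wdeg \<tau> s = 0 \<longleftrightarrow> (\<forall>k. \<tau> $ k * real (Poly_Mapping.lookup s k) = 0)"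
    and nonneg: "mon_wdeg \<tau> s \<ge> 0" for s
    by (simp_all add: mon_wdeg_def sum_nonneg_eq_0_iff sum_nonneg)
  have deg0_iff: "mon_wdeg \<tau> s = 0 \<longleftrightarrow> (\<forall>j. Poly_Mapping.lookup s (Inr j) = 0)" for s
    unfolding deg0
  proof (intro iffI allI)
    fix j assume "\<forall>k. \<tau> $ k * real (Poly_Mapping.lookup s k) = 0"
    then show "Poly_Mapping.lookup s (Inr j) = 0"
      using \<tau>(2) by (metis less_irrefl mult_eq_0_iff of_nat_eq_0_iff)
  next
    fix k assume "\<forall>j. Poly_Mapping.lookup s (Inr j) = 0"
    then show "\<tau> $ k * real (Poly_Mapping.lookup s k) = 0"
      using \<tau>(1) by (cases k) auto
  qed
  have "g \<noteq> 0"
    using is_reduced_GB_GB[OF mo I] g(1) by (auto simp: is_reduced_GB_iff[OF mo])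
  then have lead0: "mon_wdeg \<tau> (lead_mon prec g) = 0"
    using g(2) by (simp add: lt_in_KX_iff[OF mo] range_incl_mon deg0_iff)
  have "mon_wdeg \<tau> s = 0" if s: "s \<in> Poly_Mapping.keys g" for s
  proof (rule ccontr)
    assume "mon_wdeg \<tau> s \<noteq> 0"
    then have "mon_wdeg \<tau> (lead_mon prec g) < mon_wdeg \<tau> s"
      using nonneg[of s] lead0 by simp
    then have "prec (lead_mon prec g) s" "s \<noteq> lead_mon prec g"
      using ref by (auto simp: refines_weight_def)
    then show False
      using lead_mon(2)[OF mo \<open>g \<noteq> 0\<close> s] mo_asym[OF mo] by blast
  qed
  then show "g \<in> KX" by (simp add: KX_iff deg0_iff)
qed


section \<open>The elimination walk\<close>

context
  fixes I :: "('n::finite + 'm::finite, 'a::field) mpoly set"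
    and \<sigma> \<tau> :: "real ^ ('n + 'm)"
    and prec\<^sub>\<sigma> prec\<^sub>\<tau> :: "('n + 'm) mrel"
  assumes I: "ideal.subspace I"
    and \<sigma>: "\<sigma> \<in> weights" and \<tau>: "\<tau> \<in> weights"
    and \<tau>_elim: "\<forall>i. \<tau> $ Inl i = 0" "\<forall>j. \<tau> $ Inr j > 0"
    and mo_\<sigma>: "monomial_order prec\<^sub>\<sigma>" and ref_\<sigma>: "refines_weight prec\<^sub>\<sigma> \<sigma>"
    and mo_\<tau>: "monomial_order prec\<^sub>\<tau>" and ref_\<tau>: "refines_weight prec\<^sub>\<tau> \<tau>"
begin

lemma segment_weights: "\<omega> \<in> closed_segment \<sigma> \<tau> \<Longrightarrow> \<omega> \<in> weights"
  using \<sigma> \<tau> convex_weights convex_contains_segment by blast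

lemma walk_state:
  assumes "walk I \<sigma> \<tau> prec\<^sub>\<sigma> prec\<^sub>\<tau> k \<omega> prec G"
  shows "\<omega> \<in> closed_segment \<sigma> \<tau>" "monomial_order prec" "refines_weight prec \<omega>" "G = GB I prec"
    and "0 < k \<Longrightarrow> prec = weight_order \<omega> prec\<^sub>\<tau>"
proof -
  have "\<omega> \<in> closed_segment \<sigma> \<tau> \<and> monomial_order prec \<and> refines_weight prec \<omega> \<and> G = GB I prec \<and>
      (0 < k \<longrightarrow> prec = weight_order \<omega> prec\<^sub>\<tau>)"
    using assms
  proof cases
    case init
    then show ?thesis using mo_\<sigma> ref_\<sigma> by simp
  next
    case (step k' \<omega>' prec' G')
    then have "\<omega> \<in> closed_segment \<sigma> \<tau>" by (simp add: next_weight_def)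
    then show ?thesis
      using step(2,3) monomial_order_weight_order[OF mo_\<tau> segment_weights]
        refines_weight_weight_order by auto
  qed
  then show "\<omega> \<in> closed_segment \<sigma> \<tau>" "monomial_order prec" "refines_weight prec \<omega>" "G = GB I prec"
    and "0 < k \<Longrightarrow> prec = weight_order \<omega> prec\<^sub>\<tau>"
    by auto
qed

lemma ex1_next_weight:
  assumes walk: "walk I \<sigma> \<tau> prec\<^sub>\<sigma> prec\<^sub>\<tau> k \<omega> prec G"
  shows "\<exists>!\<omega>'. next_weight I \<sigma> \<tau> \<omega> prec \<omega>'"
proof -
  note st = walk_state[OF walk]
  have "\<omega> \<in> gcone I prec"
    using refined_weight_in_gcone[OF st(2) I segment_weights[OF st(1)] st(3)] .
  then have "\<exists>!\<omega>'. closed_segment \<omega> \<omega>' = closed_segment \<omega> \<tau> \<inter> gcone I prec"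
    using convex_gcone[OF st(2) I] by (intro ex1_closed_segment_Int) (simp_all add: gcone_def)
  moreover have "\<omega>' \<in> closed_segment \<sigma> \<tau>"
    if "closed_segment \<omega> \<omega>' = closed_segment \<omega> \<tau> \<inter> gcone I prec" for \<omega>'
  proof -
    have "\<omega>' \<in> closed_segment \<omega> \<tau>" using that by auto
    then show ?thesis
      using st(1) subset_closed_segment[of \<omega> \<tau> \<sigma> \<tau>] by auto
  qed
  ultimately show ?thesis unfolding next_weight_def by blast
qed

text \<open>
  The first step is excluded: the starting order refines \<open>\<sigma>\<close>, but it breaks ties arbitrarily instead
  of by \<open>prec\<^sub>\<tau>\<close>.
\<close>

lemma walk_progress:
  assumes walk: "walk I \<sigma> \<tau> prec\<^sub>\<sigma> prec\<^sub>\<tau> k \<omega> prec G" and k: "0 < k"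
    and not_elim: "\<not> specific_elim_order I prec" and nw: "next_weight I \<sigma> \<tau> \<omega> prec \<omega>'"
  shows "\<omega>' \<noteq> \<omega>"
proof
  assume "\<omega>' = \<omega>"
  then have stuck: "closed_segment \<omega> \<tau> \<inter> gcone I prec = {\<omega>}"
    using nw by (simp add: next_weight_def)
  note st = walk_state[OF walk]
  have "\<omega> \<noteq> \<tau>"
    using specific_elim_order_of_weight[OF st(2) I _ \<tau>_elim] st(3) not_elim by blast
  then show False
    using gcone_reaches_towards[OF mo_\<tau> I segment_weights[OF st(1)] \<tau> _ ref_\<tau>] stuck st(5)[OF k] by auto
qed

text \<open>
  Each step leaves the current cone for good: by convexity the cone does not meet the part of the segment
  beyond the point of exit. The current cone \<open>C\<close> differs from the cones left behind, since it contains
  the new weight \<open>\<omega>'\<close>, which is strictly closer to \<open>\<tau>\<close> than \<open>\<omega>\<close>. In the first step, no cone has been left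
  behind yet.
\<close>

lemma walk_passes_cones:
  assumes "walk I \<sigma> \<tau> prec\<^sub>\<sigma> prec\<^sub>\<tau> k \<omega> prec G"
  shows "\<exists>A. A \<subseteq> {gcone I p |p. monomial_order p} \<and> card A = k \<and>
    (\<forall>C\<in>A. C \<inter> (closed_segment \<omega> \<tau> - {\<omega>}) = {})"
  using assms
proof (induction rule: walk.induct)
  case init
  show ?case by (intro exI[of _ "{}"]) simp
next
  case (step k \<omega> prec G \<omega>')
  note st = walk_state[OF step.hyps(1)]
  define C where "C = gcone I prec"
  obtain A where A: "A \<subseteq> {gcone I p |p. monomial_order p}" "card A = k"
    and passed: "\<And>D x. D \<in> A \<Longrightarrow> x \<in> D \<Longrightarrow> x \<in> closed_segment \<omega> \<tau> \<Longrightarrow> x = \<omega>"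
    using step.IH by blast
  have fin: "finite A"
    using finite_gcones[OF I] A(1) by (rule finite_subset[rotated])
  have seg: "closed_segment \<omega> \<omega>' = closed_segment \<omega> \<tau> \<inter> C"
    using step.hyps(3) by (simp add: next_weight_def C_def)
  then have \<omega>': "\<omega>' \<in> closed_segment \<omega> \<tau>" "\<omega>' \<in> C" by auto
  have sub: "closed_segment \<omega>' \<tau> \<subseteq> closed_segment \<omega> \<tau>"
    using \<omega>'(1) by (simp add: subset_closed_segment)
  have meet: "closed_segment \<omega> \<omega>' \<inter> closed_segment \<omega>' \<tau> = {\<omega>'}"
    using \<omega>'(1) by (simp add: Int_closed_segment)
  have "C \<notin> A"
  proof
    assume "C \<in> A"
    then have "0 < k" using A(2) fin card_gt_0_iff by blast
    then have "\<omega>' \<noteq> \<omega>"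
      using walk_progress step.hyps by blast
    then show False using passed[OF \<open>C \<in> A\<close> \<omega>'(2,1)] by blast
  qed
  then have "card (insert C A) = Suc k" using A(2) fin by simp
  moreover have "insert C A \<subseteq> {gcone I p |p. monomial_order p}"
    using A(1) st(2) C_def by blast
  moreover have "x = \<omega>'" if "D \<in> insert C A" "x \<in> D" "x \<in> closed_segment \<omega>' \<tau>" for D x
  proof (cases "D = C")
    case True
    then show ?thesis using that sub seg meet by blast
  next
    case False
    then have "x = \<omega>" using passed that sub by blast
    then show ?thesis using that(3) meet by auto
  qed
  ultimately show ?case
    by (intro exI[of _ "insert C A"]) blast
qed

lemma walk_bounded:
  assumes "walk I \<sigma> \<tau> prec\<^sub>\<sigma> prec\<^sub>\<tau> k \<omega> prec G"
  shows "k \<le> card {gcone I p |p. monomial_order p}"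
proof -
  obtain A where "A \<subseteq> {gcone I p |p. monomial_order p}" "card A = k"
    using walk_passes_cones[OF assms] by blast
  then show ?thesis using card_mono[OF finite_gcones[OF I]] by blast
qed

text \<open>
  A run of maximal length must have stopped, as otherwise Step 2 would prolong it.
\<close>

lemma walk_returns_ex: "\<exists>R. walk_returns I \<sigma> \<tau> prec\<^sub>\<sigma> prec\<^sub>\<tau> R"
proof -
  let ?reached = "\<lambda>k. \<exists>\<omega> prec G. walk I \<sigma> \<tau> prec\<^sub>\<sigma> prec\<^sub>\<tau> k \<omega> prec G"
  define k where "k = Greatest ?reached"
  have bound: "\<And>j. ?reached j \<Longrightarrow> j \<le> card {gcone I p |p. monomial_order p}"
    using walk_bounded by blast
  have "?reached 0" by (blast intro: walk.init)
  then have "?reached k"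
    unfolding k_def using bound by (rule GreatestI_nat)
  have greatest: "j \<le> k" if "?reached j" for j
    unfolding k_def using that bound by (rule Greatest_le_nat)
  from \<open>?reached k\<close> obtain \<omega> prec G where walk: "walk I \<sigma> \<tau> prec\<^sub>\<sigma> prec\<^sub>\<tau> k \<omega> prec G" by blast
  have "specific_elim_order I prec"
  proof (rule ccontr)
    assume "\<not> specific_elim_order I prec"
    then have "?reached (Suc k)"
      using walk ex1_next_weight[OF walk] walk.step by blast
    then show False using greatest by fastforce
  qed
  with walk show ?thesis unfolding walk_returns_def by blast
qed

lemma walk_returns_correct:
  assumes "walk_returns I \<sigma> \<tau> prec\<^sub>\<sigma> prec\<^sub>\<tau> R"
  shows "R \<subseteq> KX \<and> (\<exists>prec. monomial_order prec \<and> specific_elim_order I prec \<and>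
    is_reduced_GB (restrict_order prec) (incl -` I) (incl -` R))"
proof -
  obtain k \<omega> prec G where walk: "walk I \<sigma> \<tau> prec\<^sub>\<sigma> prec\<^sub>\<tau> k \<omega> prec G"
    and elim: "specific_elim_order I prec" and R: "R = G \<inter> KX"
    using assms by (auto simp: walk_returns_def)
  note st = walk_state[OF walk]
  have "is_reduced_GB (restrict_order prec) (incl -` I) (incl -` R)"
    unfolding R st(4) using elim is_reduced_GB_GB[OF st(2) I]
    by (intro is_reduced_GB_elimination_ideal[OF st(2)]) (simp_all add: specific_elim_order_def)
  then show ?thesis using R st(2) elim by blast
qed

end

theorem theorem2:
  fixes F I :: "('n::finite + 'm::finite, 'a::field) mpoly set"
    and \<sigma> \<tau> :: "real ^ ('n + 'm)"
    and prec\<^sub>\<sigma> prec\<^sub>\<tau> :: "('n + 'm) mrel"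
  assumes "finite F"
    and "I = ideal_gen F"
    and "\<sigma> \<in> weights"
    and "\<tau> \<in> weights"
    and "\<forall>i. \<tau> $ Inl i = 0"
    and "\<forall>j. \<tau> $ Inr j > 0"
    and "generic_segment I \<sigma> \<tau>"
    and "monomial_order prec\<^sub>\<sigma>"
    and "refines_weight prec\<^sub>\<sigma> \<sigma>"
    and "monomial_order prec\<^sub>\<tau>"
    and "refines_weight prec\<^sub>\<tau> \<tau>"
  shows
    \<comment> \<open>Step 2 can be executed, in exactly one way, whenever it is reached\<close>
    "(\<forall>k \<omega> prec G. walk I \<sigma> \<tau> prec\<^sub>\<sigma> prec\<^sub>\<tau> k \<omega> prec G \<and> \<not> specific_elim_order I prec \<longrightarrow>
        (\<exists>!\<omega>'. next_weight I \<sigma> \<tau> \<omega> prec \<omega>')) \<and>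
     \<comment> \<open>only finitely many steps are made\<close>
     (\<exists>N. \<forall>k \<omega> prec G. walk I \<sigma> \<tau> prec\<^sub>\<sigma> prec\<^sub>\<tau> k \<omega> prec G \<longrightarrow> k \<le> N) \<and>
     \<comment> \<open>a result is returned, and every returned result is correct\<close>
     (\<exists>R. walk_returns I \<sigma> \<tau> prec\<^sub>\<sigma> prec\<^sub>\<tau> R) \<and>
     (\<forall>R. walk_returns I \<sigma> \<tau> prec\<^sub>\<sigma> prec\<^sub>\<tau> R \<longrightarrow>
        R \<subseteq> KX \<and>
        (\<exists>prec. monomial_order prec \<and> specific_elim_order I prec \<and>
           is_reduced_GB (restrict_order prec) (incl -` I) (incl -` R)))"
proof -
  have I: "ideal.subspace I"
    unfolding assms(2) by (rule ideal.subspace_span)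
  note walk_facts = I assms(3,4,5,6,8-11)
  show ?thesis
    using ex1_next_weight[OF walk_facts] walk_bounded[OF walk_facts]
      walk_returns_ex[OF walk_facts] walk_returns_correct[OF walk_facts]
    by blast
qed

end
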